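(* Let $E$ and $F$ be Fréchet spaces, and let $f, g : E \to F$ be continuous linear maps such that $g$ is onto and there exists a neighborhood $U$ of $0$ in $E$ such that the closure $\overline{f(U)}$ is compact in $F$. Then the image $(f+g)(E)$ is a closed subspace of finite codimension in $F$.
   Context: A Fréchet space is a complete, metrizable (Hausdorff) locally convex topological vector space; $E$ and $F$ are over the same scalar field, $\mathbb{R}$ or $\mathbb{C}$. A subspace $M \subseteq F$ has finite codimension if the quotient vector space $F/M$ is finite dimensional. *)

theory Defs
  imports "HOL-Analysis.Analysis"
begin

text \<open>
  The scalars range over a type of class \<^class>\<open>real_normed_field\<close>. By Ostrowski's theorem such a
  field is isometrically isomorphic, as a real algebra, to the reals or to the complex numbers, so
  the real and the complex case are treated uniformly. Real numbers act through \<^const>\<open>of_real\<close>.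

  The class \<^class>\<open>uniform_topological_group_add\<close> fixes the uniformity to be the translation
  invariant one of the additive group, with entourages \<open>{(x, y). y - x \<in> U}\<close> for neighbourhoods
  \<open>U\<close> of \<open>0\<close> (library fact \<open>cauchy_seq_finset_iff_vanishing\<close>); hence \<^term>\<open>complete UNIV\<close> says that every Cauchy filter
  of the topological vector space converges.
\<close>

locale topological_vector_space = vector_space scale
  for scale :: "'k::real_normed_field \<Rightarrow> 'a::{uniform_topological_group_add, ab_group_add} \<Rightarrow> 'a" +
  assumes continuous_scale: "continuous_on UNIV (\<lambda>(c, x). scale c x)"

definition convex_wrt :: "('k::real_normed_field \<Rightarrow> 'a::ab_group_add \<Rightarrow> 'a) \<Rightarrow> 'a set \<Rightarrow> bool" where
  "convex_wrt s S \<longleftrightarrow>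
     (\<forall>x\<in>S. \<forall>y\<in>S. \<forall>u\<ge>0. \<forall>v\<ge>0. u + v = 1 \<longrightarrow>
        s (of_real u) x + s (of_real v) y \<in> S)"

locale frechet_space = topological_vector_space scale
  for scale :: "'k::real_normed_field \<Rightarrow> 'a::{uniform_topological_group_add, ab_group_add} \<Rightarrow> 'a" +
  assumes locally_convex:
      "0 \<in> interior U \<Longrightarrow> \<exists>V. 0 \<in> interior V \<and> V \<subseteq> U \<and> convex_wrt scale V"
    and metrizable: "metrizable_space (euclidean :: 'a topology)"
    and complete: "complete (UNIV :: 'a set)"

text \<open>
  For a subspace \<open>M\<close>, the elements of the quotient space are the cosets \<open>x +o M\<close>, its zero is \<open>M\<close>,
  and its addition is elementwise addition of sets. Adding \<open>M\<close> in the scalar multiplication only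
  matters for \<open>c = 0\<close>.
\<close>

definition quotient_space :: "'a::ab_group_add set \<Rightarrow> 'a set set" where
  "quotient_space M = range (\<lambda>x. x +o M)"

definition quotient_scale ::
    "('k::field \<Rightarrow> 'a::ab_group_add \<Rightarrow> 'a) \<Rightarrow> 'a set \<Rightarrow> 'k \<Rightarrow> 'a set \<Rightarrow> 'a set" where
  "quotient_scale s M c X = s c ` X + M"

lemma (in vector_space) coset_add:
  assumes "subspace M"
  shows "(x +o M) + (y +o M) = (x + y) +o M"
proof -
  have "M + M = M"
    using subspace_add[OF assms] subspace_0[OF assms]
    by (force simp: set_plus_def)
  then show ?thesis
    by (simp add: set_plus_rearrange)
qed

lemma (in vector_space) coset_scale:
  assumes "subspace M"
  shows "quotient_scale scale M c (x +o M) = scale c x +o M"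
proof (intro set_eqI iffI)
  fix z assume "z \<in> quotient_scale scale M c (x +o M)"
  then obtain m m' where "m \<in> M" "m' \<in> M" "z = scale c x + (scale c m + m')"
    by (auto simp: quotient_scale_def set_plus_def elt_set_plus_def scale_right_distrib add.assoc)
  then show "z \<in> scale c x +o M"
    using assms by (auto simp: elt_set_plus_def intro!: subspace_add subspace_scale)
next
  fix z assume "z \<in> scale c x +o M"
  then obtain m where m: "m \<in> M" "z = scale c x + m"
    by (auto simp: elt_set_plus_def)
  moreover have "x \<in> x +o M"
    using subspace_0[OF assms] by (force simp: elt_set_plus_def)
  ultimately show "z \<in> quotient_scale scale M c (x +o M)"
    by (auto simp: quotient_scale_def set_plus_def)
qed

definition quotient_subspace ::
    "('k::field \<Rightarrow> 'a::ab_group_add \<Rightarrow> 'a) \<Rightarrow> 'a set \<Rightarrow> 'a set set \<Rightarrow> bool" where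
  "quotient_subspace s M S \<longleftrightarrow>
     S \<subseteq> quotient_space M \<and> M \<in> S \<and> (\<forall>X\<in>S. \<forall>Y\<in>S. X + Y \<in> S) \<and>
     (\<forall>c. \<forall>X\<in>S. quotient_scale s M c X \<in> S)"

definition quotient_span ::
    "('k::field \<Rightarrow> 'a::ab_group_add \<Rightarrow> 'a) \<Rightarrow> 'a set \<Rightarrow> 'a set set \<Rightarrow> 'a set set" where
  "quotient_span s M B = quotient_subspace s M hull B"

definition finite_codimension ::
    "('k::field \<Rightarrow> 'a::ab_group_add \<Rightarrow> 'a) \<Rightarrow> 'a set \<Rightarrow> bool" where
  "finite_codimension s M \<longleftrightarrow>
     (\<exists>B. finite B \<and> B \<subseteq> quotient_space M \<and> quotient_span s M B = quotient_space M)"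

end

theory Submission
  imports Defs
begin

text \<open>
  Work over the reals and write \<open>h = f + g\<close>; a disc is an absolutely convex set. For a small disc
  neighbourhood \<open>W\<close> of \<open>0\<close> let \<open>K\<close> be the closure of \<open>f(U)\<close>. Since \<open>g\<close> is open, compactness gives a
  finite-dimensional \<open>N\<close> with \<open>K \<subseteq> N + g(W)/2\<close>; substituting \<open>g = h - f\<close> repeatedly yields
  \<open>K \<subseteq> N + h(W) + K/2^n\<close> for all \<open>n\<close>, so the closure of \<open>h(W) + N\<close> is a neighbourhood of \<open>0\<close>.
  Here \<open>N\<close> depends on \<open>W\<close>, but it can be removed one dimension at a time, at the price of obtaining
  neighbourhoods of \<open>0\<close> only relative to the closure of \<open>h(E)\<close>. So \<open>h\<close> is almost open onto the closure of
  its range, and the successive approximation argument of the open mapping theorem shows that the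
  range equals its closure. Finally \<open>h(E) + N\<close>, with \<open>N\<close> belonging to \<open>W = U\<close>, is closed and a
  neighbourhood of \<open>0\<close>, hence everything.
\<close>

section \<open>Discs in Frechet spaces\<close>

lemma interior_vimage:
  fixes f :: "'c::topological_space \<Rightarrow> 'd::topological_space"
  assumes "continuous_on UNIV f" "f x \<in> interior U"
  shows "x \<in> interior (f -` U)"
proof -
  have "open (f -` interior U)" using assms(1) by (simp add: open_vimage)
  then show ?thesis
    using assms(2) interior_maximal[of "f -` interior U" "f -` U"] interior_subset by blast
qed

locale real_frechet = frechet_space scale
  for scale :: "real \<Rightarrow> 'a::{uniform_topological_group_add, ab_group_add} \<Rightarrow> 'a" (infixr "\<cdot>" 75)
begin

text \<open>The bound \<open>\<bar>u\<bar> + \<bar>v\<bar> \<le> 1\<close> covers convexity and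
  balancedness in one condition; \<open>0 \<in> A\<close> excludes the empty set.\<close>

definition disc :: "'a set \<Rightarrow> bool" where
  "disc A \<longleftrightarrow> 0 \<in> A \<and> (\<forall>x\<in>A. \<forall>y\<in>A. \<forall>u v. \<bar>u\<bar> + \<bar>v\<bar> \<le> 1 \<longrightarrow> u \<cdot> x + v \<cdot> y \<in> A)"

definition disc_nhd :: "'a set \<Rightarrow> bool" where
  "disc_nhd G \<longleftrightarrow> disc G \<and> 0 \<in> interior G"

definition line :: "'a \<Rightarrow> 'a set" where
  "line p = range (\<lambda>r. r \<cdot> p)"

text \<open>For a disc, this is its linear span.\<close>
definition cone_of :: "'a set \<Rightarrow> 'a set" where
  "cone_of A = {r \<cdot> a |r a. a \<in> A}"

section \<open>Algebra of absolutely convex sets\<close>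

lemma discD: "disc A \<Longrightarrow> x \<in> A \<Longrightarrow> y \<in> A \<Longrightarrow> \<bar>u\<bar> + \<bar>v\<bar> \<le> 1 \<Longrightarrow> u \<cdot> x + v \<cdot> y \<in> A"
  by (auto simp: disc_def)

lemma disc_0: "disc A \<Longrightarrow> 0 \<in> A"
  by (auto simp: disc_def)

lemma disc_scale: "disc A \<Longrightarrow> x \<in> A \<Longrightarrow> \<bar>u\<bar> \<le> 1 \<Longrightarrow> u \<cdot> x \<in> A"
  using discD[of A x x u 0] by simp

lemma disc_uminus: "disc A \<Longrightarrow> x \<in> A \<Longrightarrow> - x \<in> A"
  using disc_scale[of A x "-1"] by simp

lemma disc_sum3:
  assumes "disc A" "x \<in> A" "y \<in> A" "z \<in> A" "\<bar>u\<bar> + \<bar>v\<bar> + \<bar>w\<bar> \<le> 1"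
  shows "u \<cdot> x + v \<cdot> y + w \<cdot> z \<in> A"
proof (cases "u = 0 \<and> v = 0")
  case True
  then show ?thesis using assms disc_scale[of A z w] by simp
next
  case False
  \<comment> \<open>Normalising by \<open>t\<close> turns the first two terms into a single point of
    \<open>A\<close>; a second two-term combination then adds \<open>z\<close>.\<close>
  define t where "t = \<bar>u\<bar> + \<bar>v\<bar>"
  have t: "t > 0" using False by (auto simp: t_def)
  have "\<bar>u/t\<bar> + \<bar>v/t\<bar> = t/t"
    using t by (metis t_def abs_divide abs_of_pos add_divide_distrib)
  then have "(u/t) \<cdot> x + (v/t) \<cdot> y \<in> A"
    using assms(1-3) t by (intro discD) auto
  then have "t \<cdot> ((u/t) \<cdot> x + (v/t) \<cdot> y) + w \<cdot> z \<in> A"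
    using assms t by (intro discD[OF assms(1) _ assms(4)]) (auto simp: t_def)
  then show ?thesis using t by (simp add: scale_right_distrib)
qed

lemma disc_Int: "disc A \<Longrightarrow> disc B \<Longrightarrow> disc (A \<inter> B)"
  by (auto simp: disc_def)

lemma disc_plus:
  assumes "disc A" "disc B"
  shows "disc (A + B)"
  unfolding disc_def
proof (intro conjI ballI allI impI)
  show "0 \<in> A + B"
    using assms[THEN disc_0] by (force simp: set_plus_def)
  fix x y u v assume "x \<in> A + B" "y \<in> A + B" and uv: "\<bar>u\<bar> + \<bar>v\<bar> \<le> (1::real)"
  then obtain a b a' b' where "x = a + b" "y = a' + b'" "a \<in> A" "b \<in> B" "a' \<in> A" "b' \<in> B"
    by (auto simp: set_plus_def)
  moreover from this have "u \<cdot> x + v \<cdot> y = (u \<cdot> a + v \<cdot> a') + (u \<cdot> b + v \<cdot> b')"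
    by (simp add: scale_right_distrib add_ac)
  ultimately show "u \<cdot> x + v \<cdot> y \<in> A + B"
    using discD[OF assms(1) _ _ uv] discD[OF assms(2) _ _ uv] by (simp add: set_plus_intro)
qed

lemma disc_subspace: "subspace S \<Longrightarrow> disc S"
  by (auto simp: disc_def subspace_0 subspace_add subspace_scale)

lemma disc_scaled:
  assumes "disc A"
  shows "disc ((\<cdot>) c ` A)"
  unfolding disc_def
proof (intro conjI ballI allI impI)
  show "0 \<in> (\<cdot>) c ` A" using disc_0[OF assms] by force
  fix x y u v assume "x \<in> (\<cdot>) c ` A" "y \<in> (\<cdot>) c ` A" and uv: "\<bar>u\<bar> + \<bar>v\<bar> \<le> (1::real)"
  then obtain a b where "x = c \<cdot> a" "y = c \<cdot> b" "a \<in> A" "b \<in> A" by auto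
  then show "u \<cdot> x + v \<cdot> y \<in> (\<cdot>) c ` A"
    using discD[OF assms _ _ uv, of a b]
    by (intro image_eqI[of _ _ "u \<cdot> a + v \<cdot> b"]) (auto simp: scale_right_distrib mult.commute)
qed

lemma subspace_line: "subspace (line p)"
  unfolding line_def
  by (auto simp: subspace_def intro: range_eqI[of 0 _ 0] simp flip: scale_left_distrib)

section \<open>Disc neighbourhoods of zero\<close>

lemma continuous_on_scale [continuous_intros]:
  "continuous_on S a \<Longrightarrow> continuous_on S b \<Longrightarrow> continuous_on S (\<lambda>x. a x \<cdot> b x)"
  using continuous_on_compose2[OF continuous_scale, of S "\<lambda>x. (a x, b x)"]
  by (auto intro: continuous_on_Pair)

lemma continuous_on_add_left: "continuous_on UNIV (\<lambda>x::'a. a + x)"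
  by (intro continuous_intros)

lemma nhd_scale:
  assumes "0 \<in> interior G" "c \<noteq> 0"
  shows "0 \<in> interior ((\<cdot>) c ` G)"
proof -
  have "0 \<in> interior ((\<lambda>x. inverse c \<cdot> x) -` G)"
    using assms by (intro interior_vimage) (auto intro!: continuous_intros)
  moreover have "(\<lambda>x. inverse c \<cdot> x) -` G \<subseteq> (\<cdot>) c ` G"
  proof
    fix x assume "x \<in> (\<lambda>x. inverse c \<cdot> x) -` G"
    then show "x \<in> (\<cdot>) c ` G"
      using assms by (intro image_eqI[of _ _ "inverse c \<cdot> x"]) auto
  qed
  ultimately show ?thesis using interior_mono by blast
qed

text \<open>Local convexity gives a convex \<open>V\<close>; intersecting it with its reflection
  makes it symmetric, and a convex symmetric set containing 0 is absolutely convex.\<close>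

lemma disc_nhd_subset:
  assumes "0 \<in> interior U"
  obtains G where "disc_nhd G" "G \<subseteq> U"
proof -
  obtain V where V: "0 \<in> interior V" "V \<subseteq> U" "convex_wrt scale V"
    using locally_convex[OF assms] by blast
  let ?G = "V \<inter> (\<lambda>x. - x) -` V"
  have cv: "u \<cdot> x + v \<cdot> y \<in> V" if "x \<in> V" "y \<in> V" "u \<ge> 0" "v \<ge> 0" "u + v = 1" for x y u v
    using V(3) that by (auto simp: convex_wrt_def)
  have V0: "0 \<in> V" using V(1) interior_subset by blast
  have sc: "u \<cdot> x \<in> V" if "x \<in> V" "0 \<le> u" "u \<le> 1" for x u
    using cv[of x 0 u "1-u"] that V0 by simp
  have sc': "u \<cdot> x \<in> ?G" if "x \<in> ?G" "\<bar>u\<bar> \<le> 1" for x u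
    using sc[of x "\<bar>u\<bar>"] sc[of "-x" "\<bar>u\<bar>"] that by (cases "u \<ge> 0") auto
  have cv': "u \<cdot> x + v \<cdot> y \<in> ?G" if "x \<in> ?G" "y \<in> ?G" "u \<ge> 0" "v \<ge> 0" "u + v = 1" for x y u v
    using cv[of x y u v] cv[of "-x" "-y" u v] that by auto
  have "disc ?G"
    unfolding disc_def
  proof (intro conjI ballI allI impI)
    fix x y u v assume xy: "x \<in> ?G" "y \<in> ?G" and uv: "\<bar>u\<bar> + \<bar>v\<bar> \<le> (1::real)"
    define s where "s = sgn u"
    define t where "t = sgn v"
    \<comment> \<open>The combination is rewritten as a convex one with weights
      \<open>\<bar>u\<bar>\<close> and \<open>1 - \<bar>u\<bar>\<close>. If
      \<open>\<bar>u\<bar> = 1\<close>, then \<open>v = 0\<close> and the division by zero yields 0,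
      as it should.\<close>
    have "\<bar>u\<bar> \<cdot> (s \<cdot> x) + (1 - \<bar>u\<bar>) \<cdot> ((v / (1 - \<bar>u\<bar>)) \<cdot> y) \<in> ?G"
    proof (intro cv' sc' xy)
      show "\<bar>v / (1 - \<bar>u\<bar>)\<bar> \<le> 1" using uv by (auto simp: divide_le_eq_1)
    qed (use uv in \<open>auto simp: s_def sgn_if\<close>)
    moreover have "(1 - \<bar>u\<bar>) \<cdot> ((v / (1 - \<bar>u\<bar>)) \<cdot> y) = v \<cdot> y"
      using uv by (cases "\<bar>u\<bar> = 1") auto
    moreover have "\<bar>u\<bar> \<cdot> (s \<cdot> x) = u \<cdot> x"
      by (simp add: s_def abs_mult_sgn)
    ultimately show "u \<cdot> x + v \<cdot> y \<in> ?G"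
      by (simp only:)
  qed (use V0 in auto)
  moreover have "0 \<in> interior ?G"
    unfolding interior_Int using V(1)
    by (auto intro!: interior_vimage continuous_intros)
  ultimately show thesis
    using that[of ?G] V(2) by (auto simp: disc_nhd_def)
qed

lemma disc_nhd_Int: "disc_nhd A \<Longrightarrow> disc_nhd B \<Longrightarrow> disc_nhd (A \<inter> B)"
  by (auto simp: disc_nhd_def disc_Int)

lemma disc_nhd_scaled: "disc_nhd A \<Longrightarrow> c \<noteq> 0 \<Longrightarrow> disc_nhd ((\<cdot>) c ` A)"
  by (auto simp: disc_nhd_def disc_scaled nhd_scale)

lemma disc_nhd_disc: "disc_nhd A \<Longrightarrow> disc A"
  by (simp add: disc_nhd_def)

lemma disc_nhd_UNIV: "disc_nhd UNIV"
  by (auto simp: disc_nhd_def disc_def)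

lemma absorbs:
  assumes "disc_nhd G"
  obtains e where "e > 0" "\<And>r. \<bar>r\<bar> \<le> e \<Longrightarrow> r \<cdot> x \<in> G"
proof -
  have "0 \<in> interior ((\<lambda>r. r \<cdot> x) -` G)"
    using assms by (intro interior_vimage) (auto intro!: continuous_intros simp: disc_nhd_def)
  then obtain d where "d > 0" "ball 0 d \<subseteq> (\<lambda>r. r \<cdot> x) -` G"
    by (auto simp: mem_interior)
  then show thesis
    by (intro that[of "d/2"]) (auto simp: subset_eq)
qed

lemma absorbs_pos:
  assumes "disc_nhd G"
  obtains e where "e > 0" "e \<cdot> x \<in> G"
proof -
  obtain e where "e > 0" "\<And>r. \<bar>r\<bar> \<le> e \<Longrightarrow> r \<cdot> x \<in> G"
    using absorbs[OF assms, of x] by blast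
  then show thesis using that[of e] by simp
qed

section \<open>Closures of discs and subspaces\<close>

text \<open>By \<open>disc_nhd_subset\<close> the translates of disc neighbourhoods form a
  neighbourhood base at each point, so closures can be handled by linear algebra with small
  errors.\<close>

lemma closure_iff_disc_nhd: "x \<in> closure S \<longleftrightarrow> (\<forall>G. disc_nhd G \<longrightarrow> (\<exists>y\<in>S. y - x \<in> G))"
proof safe
  fix G assume x: "x \<in> closure S" and G: "disc_nhd G"
  have "x \<in> interior ((\<lambda>y. y - x) -` G)"
    using G by (intro interior_vimage) (auto intro!: continuous_intros simp: disc_nhd_def)
  then show "\<exists>y\<in>S. y - x \<in> G"
    using x interior_subset closure_iff_nhds_not_empty[of x S] by fastforce
next
  assume *: "\<forall>G. disc_nhd G \<longrightarrow> (\<exists>y\<in>S. y - x \<in> G)"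
  show "x \<in> closure S"
    unfolding closure_iff_nhds_not_empty
  proof (intro allI impI)
    fix A V assume A: "V \<subseteq> A" "open V" "x \<in> V"
    have "0 \<in> interior ((\<lambda>y. x + y) -` A)"
      using A by (intro interior_vimage) (auto intro!: continuous_intros interiorI)
    then obtain G where "disc_nhd G" "G \<subseteq> (\<lambda>y. x + y) -` A"
      by (rule disc_nhd_subset)
    with * show "S \<inter> A \<noteq> {}" by fastforce
  qed
qed

lemma closure_memD: "x \<in> closure S \<Longrightarrow> disc_nhd G \<Longrightarrow> \<exists>y\<in>S. y - x \<in> G"
  by (simp add: closure_iff_disc_nhd)

lemma disc_closure:
  assumes "disc A"
  shows "disc (closure A)"
  unfolding disc_def
proof (intro conjI ballI allI impI)
  show "0 \<in> closure A" using disc_0[OF assms] closure_subset by blast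
  fix x y u v assume xy: "x \<in> closure A" "y \<in> closure A" and uv: "\<bar>u\<bar> + \<bar>v\<bar> \<le> (1::real)"
  show "u \<cdot> x + v \<cdot> y \<in> closure A"
    unfolding closure_iff_disc_nhd
  proof (intro allI impI)
    fix G assume G: "disc_nhd G"
    then obtain a b where "a \<in> A" "a - x \<in> G" "b \<in> A" "b - y \<in> G"
      using closure_memD xy by meson
    then show "\<exists>z\<in>A. z - (u \<cdot> x + v \<cdot> y) \<in> G"
      using discD[OF assms _ _ uv, of a b] discD[OF disc_nhd_disc[OF G] _ _ uv, of "a - x" "b - y"]
      by (intro bexI[of _ "u \<cdot> a + v \<cdot> b"]) (auto simp: scale_right_diff_distrib algebra_simps)
  qed
qed

lemma subspace_closure:
  assumes "subspace S"
  shows "subspace (closure S)"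
proof -
  have d: "disc (closure S)" using assms by (intro disc_closure disc_subspace)
  have sc: "c \<cdot> x \<in> closure S" if x: "x \<in> closure S" for c x
    unfolding closure_iff_disc_nhd
  proof (intro allI impI)
    fix G assume G: "disc_nhd G"
    show "\<exists>y\<in>S. y - c \<cdot> x \<in> G"
    proof (cases "c = 0")
      case True
      then show ?thesis using subspace_0[OF assms] disc_0[OF disc_nhd_disc[OF G]] by force
    next
      case False
      \<comment> \<open>Approximating \<open>x\<close> within \<open>G\<close> scaled by
        \<open>1/c\<close> approximates \<open>c \<cdot> x\<close> within \<open>G\<close>.\<close>
      obtain y where y: "y \<in> S" "y - x \<in> (\<cdot>) (1/c) ` G"
        using closure_memD[OF x disc_nhd_scaled[OF G, of "1/c"]] False by auto
      then obtain g where g: "g \<in> G" "y - x = (1/c) \<cdot> g" by auto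
      have "c \<cdot> y - c \<cdot> x = c \<cdot> (y - x)" by (simp add: scale_right_diff_distrib)
      also have "\<dots> = g" using g False by simp
      finally show ?thesis using g y subspace_scale[OF assms] by metis
    qed
  qed
  have "x + y \<in> closure S" if "x \<in> closure S" "y \<in> closure S" for x y
  proof -
    \<comment> \<open>A disc contains midpoints; closure under scaling then doubles the midpoint to
      the sum.\<close>
    have "(1/2) \<cdot> x + (1/2) \<cdot> y \<in> closure S" using discD[OF d that, of "1/2" "1/2"] by simp
    then have "2 \<cdot> ((1/2) \<cdot> x + (1/2) \<cdot> y) \<in> closure S" by (rule sc)
    then show ?thesis by (simp add: scale_right_distrib)
  qed
  then show ?thesis using sc d by (auto simp: subspace_def disc_0)
qed

lemma scale_third_sum:
  assumes "disc A" "x \<in> A" "y \<in> A" "z \<in> A"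
  shows "(1/3) \<cdot> (x + y + z) \<in> A"
  using disc_sum3[OF assms, of "1/3" "1/3" "1/3"] by (simp add: scale_right_distrib)

lemma disc_nhd_half:
  assumes "disc_nhd G"
  obtains G' where "disc_nhd G'" "\<And>x y. x \<in> G' \<Longrightarrow> y \<in> G' \<Longrightarrow> x + y \<in> G"
proof (rule that[of "(\<cdot>) (1/2) ` G"])
  show "disc_nhd ((\<cdot>) (1/2) ` G)" using assms by (intro disc_nhd_scaled) auto
  fix x y assume "x \<in> (\<cdot>) (1/2) ` G" "y \<in> (\<cdot>) (1/2) ` G"
  then show "x + y \<in> G"
    using discD[OF disc_nhd_disc[OF assms], of _ _ "1/2" "1/2"] by auto
qed

section \<open>Countable bases, convergence of series and barrels\<close>

text \<open>Metrizability enters through first countability; each member of a countable base at 0 is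
  shrunk to a disc.\<close>

lemma countable_base:
  "\<exists>V. (\<forall>n::nat. disc_nhd (V n)) \<and> (\<forall>G. 0 \<in> interior G \<longrightarrow> (\<exists>n. V n \<subseteq> G))"
proof -
  have "first_countable (euclidean :: 'a topology)"
    using metrizable metrizable_imp_first_countable by blast
  then have "\<exists>\<B>. countable \<B> \<and> (\<forall>V\<in>\<B>. open V) \<and>
      (\<forall>U. open U \<and> (0::'a) \<in> U \<longrightarrow> (\<exists>V\<in>\<B>. 0 \<in> V \<and> V \<subseteq> U))"
    unfolding first_countable_def by simp
  then obtain \<B> where B: "countable \<B>" "\<And>V. V \<in> \<B> \<Longrightarrow> open V"
      "\<And>U. open U \<Longrightarrow> (0::'a) \<in> U \<Longrightarrow> \<exists>V\<in>\<B>. 0 \<in> V \<and> V \<subseteq> U"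
    by metis
  let ?B = "{V\<in>\<B>. 0 \<in> V}"
  have ne: "?B \<noteq> {}" using B(3)[of UNIV] by auto
  have cB: "countable ?B" using B(1) by (rule countable_subset[rotated]) auto
  define b where "b = from_nat_into ?B"
  have b: "b n \<in> ?B" for n unfolding b_def using ne by (rule from_nat_into)
  have "\<forall>n. \<exists>G. disc_nhd G \<and> G \<subseteq> b n"
    using b B(2) by (metis (mono_tags, lifting) disc_nhd_subset interior_open mem_Collect_eq)
  then obtain V where V: "\<And>n. disc_nhd (V n)" "\<And>n. V n \<subseteq> b n" by metis
  have "\<exists>n. V n \<subseteq> G" if "0 \<in> interior G" for G
  proof -
    from that
    obtain B0 where "B0 \<in> ?B" "B0 \<subseteq> interior G" using B(3)[of "interior G"] by auto
    moreover from this obtain n where "b n = B0"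
      unfolding b_def using from_nat_into_surj[OF cB] by blast
    ultimately have "b n \<subseteq> interior G" by simp
    then show ?thesis using V(2) interior_subset by blast
  qed
  then show ?thesis using V(1) by blast
qed

text \<open>Such a sequence stands in for the balls of radius \<open>2^-n\<close> of a
  translation-invariant metric.\<close>

definition halving_base :: "(nat \<Rightarrow> 'a set) \<Rightarrow> bool" where
  "halving_base W \<longleftrightarrow> (\<forall>n. disc_nhd (W n)) \<and>
     (\<forall>n. \<forall>x\<in>W (Suc n). \<forall>y\<in>W (Suc n). x + y \<in> W n) \<and>
     (\<forall>G. 0 \<in> interior G \<longrightarrow> (\<exists>n. W n \<subseteq> G))"

lemma halving_base_nhd: "halving_base W \<Longrightarrow> disc_nhd (W n)"
  by (simp add: halving_base_def)

lemma halving_base_add: "halving_base W \<Longrightarrow> x \<in> W (Suc n) \<Longrightarrow> y \<in> W (Suc n) \<Longrightarrow> x + y \<in> W n"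
  by (simp add: halving_base_def)

lemma halving_base_subset:
  assumes "halving_base W" "disc_nhd G"
  obtains n where "W n \<subseteq> G"
  using assms by (auto simp: halving_base_def disc_nhd_def)

lemma halving_base_antimono:
  assumes "halving_base W" "m \<le> n"
  shows "W n \<subseteq> W m"
proof -
  have "W (Suc n) \<subseteq> W n" for n
    using halving_base_add[OF assms(1), of _ n 0] disc_0[OF disc_nhd_disc[OF halving_base_nhd[OF assms(1)]]]
    by auto
  then show ?thesis using assms(2) by (rule lift_Suc_antimono_le)
qed

text \<open>Recursive choice: halve the previous disc, then intersect with \<open>W0\<close> and the
  next member of a countable base.\<close>

lemma halving_base_exists:
  assumes "disc_nhd W0"
  obtains W where "halving_base W" "W 0 \<subseteq> W0"
proof -
  obtain V where V: "\<And>n::nat. disc_nhd (V n)" "\<And>G. 0 \<in> interior G \<Longrightarrow> \<exists>n. V n \<subseteq> G"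
    using countable_base by metis
  have "\<exists>W. \<forall>n. (disc_nhd (W n) \<and> W n \<subseteq> V n \<inter> W0) \<and> (\<forall>x\<in>W (Suc n). \<forall>y\<in>W (Suc n). x + y \<in> W n)"
  proof (rule dependent_nat_choice)
    show "\<exists>G. disc_nhd G \<and> G \<subseteq> V 0 \<inter> W0"
      using disc_nhd_Int[OF V(1) assms] by blast
    fix G n assume G: "disc_nhd G \<and> G \<subseteq> V n \<inter> W0"
    then obtain G' where "disc_nhd G'" "\<And>x y. x \<in> G' \<Longrightarrow> y \<in> G' \<Longrightarrow> x + y \<in> G"
      using disc_nhd_half by blast
    then show "\<exists>H. (disc_nhd H \<and> H \<subseteq> V (Suc n) \<inter> W0) \<and> (\<forall>x\<in>H. \<forall>y\<in>H. x + y \<in> G)"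
      using V(1) assms by (intro exI[of _ "G' \<inter> (V (Suc n) \<inter> W0)"]) (auto intro!: disc_nhd_Int)
  qed
  then obtain W where W: "\<And>n. disc_nhd (W n)" "\<And>n. W n \<subseteq> V n \<inter> W0"
      "\<And>n x y. x \<in> W (Suc n) \<Longrightarrow> y \<in> W (Suc n) \<Longrightarrow> x + y \<in> W n" by metis
  show thesis
  proof (rule that[of W])
    show "halving_base W"
      unfolding halving_base_def using W V(2) by (meson le_inf_iff order_trans)
  qed (use W in auto)
qed

text \<open>
  The steps after the \<open>n\<close>-th partial sum add up to an element of \<open>W n + W n\<close>; the third summand comes
  from passing to the limit.
\<close>
lemma summable_steps:
  assumes W: "halving_base W"
    and step: "\<And>n. s (Suc n) - s n \<in> W n"
  shows "\<exists>x. (\<forall>G. disc_nhd G \<longrightarrow> (\<exists>N. \<forall>n\<ge>N. s n - x \<in> G)) \<and> (\<forall>n. (1/3) \<cdot> (x - s n) \<in> W n)"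
proof -
  have dW: "disc (W n)" for n using halving_base_nhd[OF W] disc_nhd_disc by blast
  note half = halving_base_add[OF W]
  have tail: "\<exists>a\<in>W n. \<exists>b\<in>W n. s (n + d) - s n = a + b" for n d
  proof (induction d arbitrary: n)
    case 0
    then show ?case using disc_0[OF dW] by force
  next
    case (Suc d)
    obtain a b where "a \<in> W (Suc n)" "b \<in> W (Suc n)" "s (Suc n + d) - s (Suc n) = a + b"
      using Suc.IH by blast
    then have "a + b \<in> W n" "s (n + Suc d) - s n = (a + b) + (s (Suc n) - s n)"
      using half by (auto simp: algebra_simps)
    then show ?case using step by blast
  qed
  have "Cauchy s"
    unfolding Cauchy_uniform_iff
  proof (intro allI impI)
    fix P :: "'a \<times> 'a \<Rightarrow> bool" assume "eventually P uniformity"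
    \<comment> \<open>In a topological group every entourage contains all pairs whose difference is
      close enough to 0.\<close>
    then obtain Q where Q: "eventually Q (nhds 0)" "\<And>x y. Q (y - x) \<Longrightarrow> P (x, y)"
      unfolding cauchy_seq_finset_iff_vanishing by (auto simp: eventually_filtercomap)
    have "0 \<in> interior (Collect Q)"
      using Q(1) by (auto simp: eventually_nhds interior_def)
    then obtain n where n: "W n \<subseteq> Collect Q" using W by (auto simp: halving_base_def)
    \<comment> \<open>The index \<open>n + 2\<close> pays for two halvings: one merges the two
      summands of a tail, the other the two deviations from the reference term.\<close>
    have near: "s m - s (Suc (Suc n)) \<in> W (Suc n)" if "m \<ge> Suc (Suc n)" for m
      using tail[of "Suc (Suc n)" "m - Suc (Suc n)"] that half by (metis le_add_diff_inverse)
    have "P (s m, s m')" if "m \<ge> Suc (Suc n)" "m' \<ge> Suc (Suc n)" for m m'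
    proof -
      have "(s m' - s (Suc (Suc n))) + - (s m - s (Suc (Suc n))) \<in> W n"
        by (intro half near disc_uminus[OF dW] that)
      then show ?thesis using n Q(2) by auto
    qed
    then show "\<exists>N. \<forall>n\<ge>N. \<forall>m\<ge>N. P (s n, s m)" by blast
  qed
  then obtain x where "filtermap s sequentially \<le> nhds x"
    using cauchy_filter_complete_converges[OF _ complete, of "filtermap s sequentially"]
    unfolding Cauchy_uniform by (auto simp: filtermap_bot_iff)
  then have lim: "s \<longlonglongrightarrow> x" by (simp add: filterlim_def)
  have conv: "\<exists>N. \<forall>n\<ge>N. s n - x \<in> G" if G: "disc_nhd G" for G
  proof -
    have "x \<in> interior ((\<lambda>y. y - x) -` G)"
      using G by (intro interior_vimage) (auto intro!: continuous_intros simp: disc_nhd_def)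
    with lim have "eventually (\<lambda>n. s n \<in> interior ((\<lambda>y. y - x) -` G)) sequentially"
      by (intro topological_tendstoD) auto
    then show ?thesis using interior_subset by (fastforce simp: eventually_sequentially)
  qed
  moreover have "(1/3) \<cdot> (x - s n) \<in> W n" for n
  proof -
    obtain N where N: "\<And>m. m \<ge> N \<Longrightarrow> s m - x \<in> W n" using conv[OF halving_base_nhd[OF W]] by blast
    obtain a b where ab: "a \<in> W n" "b \<in> W n" "s (n + N) - s n = a + b" using tail by blast
    have "(1/3) \<cdot> (- (s (n + N) - x) + a + b) \<in> W n"
      by (intro scale_third_sum dW disc_uminus N ab) auto
    moreover have "- (s (n + N) - x) + a + b = x - s n"
      unfolding diff_eq_eq[THEN iffD1, OF ab(3)] by (simp add: algebra_simps)
    ultimately show ?thesis by (simp only:)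
  qed
  ultimately show ?thesis by blast
qed

text \<open>A Baire category argument by hand: if \<open>C\<close> is not a neighbourhood of 0, no
  multiple of it contains a translated neighbourhood, so shrinking translated discs can be chosen to
  avoid the integer multiples of \<open>C\<close> one after another. By completeness some point lies
  in none of them, which contradicts absorption.\<close>

lemma barrel_nhd:
  assumes C: "closed C" "disc C" and absorbing: "\<And>x. \<exists>r. r \<noteq> 0 \<and> r \<cdot> x \<in> C"
  shows "0 \<in> interior C"
proof (rule ccontr)
  assume notin: "0 \<notin> interior C"
  \<comment> \<open>Otherwise half the difference between a point of the translate and its centre,
    both scaled by \<open>c\<close>, would put a multiple of \<open>G\<close> into
    \<open>C\<close>.\<close>
  have out: "\<exists>g\<in>G. c \<cdot> (x + g) \<notin> C" if G: "disc_nhd G" and c: "c \<noteq> 0" for x G c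
  proof (rule ccontr)
    assume "\<not> ?thesis"
    then have in_C: "c \<cdot> (x + g) \<in> C" if "g \<in> G" for g using that by blast
    have "(c/2) \<cdot> g \<in> C" if "g \<in> G" for g
    proof -
      have "(1/2) \<cdot> (c \<cdot> (x + g)) + (-1/2) \<cdot> (c \<cdot> (x + 0)) \<in> C"
        by (intro discD[OF C(2)] in_C that disc_0 disc_nhd_disc G) auto
      then show ?thesis by (simp add: scale_right_distrib)
    qed
    then have "(\<cdot>) (c/2) ` G \<subseteq> C" by auto
    moreover have "0 \<in> interior ((\<cdot>) (c/2) ` G)"
      using G c by (intro nhd_scale) (auto simp: disc_nhd_def)
    ultimately show False using notin interior_mono by blast
  qed
  obtain V where V: "\<And>n::nat. disc_nhd (V n)" "\<And>G. 0 \<in> interior G \<Longrightarrow> \<exists>n. V n \<subseteq> G"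
    using countable_base by metis
  \<comment> \<open>A state is a pair of the current point and a disc bounding the next step. The
    factor 3 matches the factor \<open>1/3\<close> in \<open>summable_steps\<close>, so the limit
    inherits the avoidance condition.\<close>
  define step where "step n q q' \<longleftrightarrow> fst q' - fst q \<in> snd q \<and>
      (\<forall>a\<in>snd q'. \<forall>b\<in>snd q'. a + b \<in> snd q) \<and>
      (\<forall>g\<in>snd q'. (1 / real (Suc n)) \<cdot> (fst q' + 3 \<cdot> g) \<notin> C)"
    for n and q q' :: "'a \<times> 'a set"
  have "\<exists>p. \<forall>n. (disc_nhd (snd (p n)) \<and> snd (p n) \<subseteq> V n) \<and> step n (p n) (p (Suc n))"
  proof (rule dependent_nat_choice)
    show "\<exists>q. disc_nhd (snd q) \<and> snd q \<subseteq> V 0" using V(1) by (metis snd_conv order_refl)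
    fix q :: "'a \<times> 'a set" and n assume q: "disc_nhd (snd q) \<and> snd q \<subseteq> V n"
    then obtain g where g: "g \<in> snd q" "(1 / real (Suc n)) \<cdot> (fst q + g) \<notin> C"
      using out[of "snd q" "1 / real (Suc n)" "fst q"] by auto
    let ?x = "fst q + g"
    obtain G1 where G1: "disc_nhd G1" "\<And>x y. x \<in> G1 \<Longrightarrow> y \<in> G1 \<Longrightarrow> x + y \<in> snd q"
      using q disc_nhd_half by blast
    \<comment> \<open>As \<open>C\<close> is closed, avoidance at the new point persists under small
      perturbations.\<close>
    have "0 \<in> interior ((\<lambda>g. (1 / real (Suc n)) \<cdot> (?x + 3 \<cdot> g)) -` (- C))"
      using g C(1) by (intro interior_vimage)
        (auto intro!: continuous_intros simp: interior_open open_Compl simp del: of_nat_Suc)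
    then obtain G2 where G2: "disc_nhd G2" "G2 \<subseteq> (\<lambda>g. (1 / real (Suc n)) \<cdot> (?x + 3 \<cdot> g)) -` (- C)"
      by (rule disc_nhd_subset)
    have "step n q (?x, G1 \<inter> G2 \<inter> V (Suc n))"
      unfolding step_def using g(1) G1(2) G2(2) by (simp add: subset_eq del: of_nat_Suc)
    moreover have "disc_nhd (G1 \<inter> G2 \<inter> V (Suc n))"
      using G1(1) G2(1) V(1) by (intro disc_nhd_Int)
    ultimately show "\<exists>q'. (disc_nhd (snd q') \<and> snd q' \<subseteq> V (Suc n)) \<and> step n q q'"
      by (intro exI[of _ "(?x, G1 \<inter> G2 \<inter> V (Suc n))"]) simp
  qed
  then obtain p where p: "\<And>n. disc_nhd (snd (p n))" "\<And>n. snd (p n) \<subseteq> V n"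
      "\<And>n. step n (p n) (p (Suc n))"
    by blast
  have "halving_base (\<lambda>n. snd (p n))"
    unfolding halving_base_def
  proof (intro conjI allI impI)
    show "\<forall>x\<in>snd (p (Suc n)). \<forall>y\<in>snd (p (Suc n)). x + y \<in> snd (p n)" for n
      using p(3)[of n] by (simp add: step_def)
    fix G :: "'a set" assume "0 \<in> interior G"
    then obtain n where "V n \<subseteq> G" using V(2) by blast
    then show "\<exists>n. snd (p n) \<subseteq> G" using p(2)[of n] by (intro exI[of _ n]) simp
  qed (fact p(1))
  moreover have "fst (p (Suc n)) - fst (p n) \<in> snd (p n)" for n
    using p(3)[of n] by (simp add: step_def)
  ultimately obtain x where x: "\<forall>n. (1/3) \<cdot> (x - fst (p n)) \<in> snd (p n)"
    using summable_steps[of "\<lambda>n. snd (p n)" "\<lambda>n. fst (p n)"] by auto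
  have x_out: "(1 / real (Suc n)) \<cdot> x \<notin> C" for n
  proof -
    have "(1 / real (Suc n)) \<cdot> (fst (p (Suc n)) + 3 \<cdot> ((1/3) \<cdot> (x - fst (p (Suc n))))) \<notin> C"
      using p(3)[of n] spec[OF x, of "Suc n"] unfolding step_def by blast
    then show ?thesis by simp
  qed
  obtain r where r: "r \<noteq> 0" "r \<cdot> x \<in> C" using absorbing by blast
  \<comment> \<open>Scaling \<open>r \<cdot> x\<close> by a factor of modulus at most 1 brings the
    \<open>1/(n+1)\<close> multiple of \<open>x\<close> into \<open>C\<close>.\<close>
  obtain n where n: "1 / real (Suc n) < \<bar>r\<bar>" using r(1) nat_approx_posE[of "\<bar>r\<bar>"] by auto
  have "(1 / real (Suc n) / r) \<cdot> (r \<cdot> x) \<in> C"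
  proof (rule disc_scale[OF C(2) r(2)])
    have "\<bar>1 / real (Suc n) / r\<bar> = (1 / real (Suc n)) / \<bar>r\<bar>"
      by (simp add: abs_mult)
    then show "\<bar>1 / real (Suc n) / r\<bar> \<le> 1"
      using n r(1) by (metis divide_le_eq_1_pos less_imp_le zero_less_abs_iff)
  qed
  then show False using x_out[of n] r(1) by simp
qed

lemma eq_0_if_in_all_nhds:
  assumes "\<And>G. disc_nhd G \<Longrightarrow> z \<in> G"
  shows "z = 0"
proof -
  have "t1_space (euclidean :: 'a topology)"
    using metrizable by (simp add: metrizable_imp_Hausdorff_space Hausdorff_imp_t1_space)
  then have "closed {0::'a}" by (simp add: t1_space_closedin_singleton)
  moreover have "z \<in> closure {0}"
    unfolding closure_iff_disc_nhd using assms disc_uminus disc_nhd_disc by fastforce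
  ultimately show ?thesis by simp
qed

section \<open>Finite-dimensional perturbations of discs\<close>

text \<open>Closed plus compact is closed: for \<open>x\<close> outside the sum, the tube lemma
  provides a neighbourhood of \<open>x\<close> that works for all parameters \<open>s\<close> in the
  compact interval at once.\<close>

lemma closed_plus_segment:
  assumes "closed A"
  shows "closed (A + (\<lambda>s. s \<cdot> p) ` {-T..T})"
  unfolding closed_def
proof (rule topological_space_class.openI)
  fix x assume x: "x \<in> - (A + (\<lambda>s. s \<cdot> p) ` {-T..T})"
  let ?W = "(\<lambda>(x, s). x - s \<cdot> p) -` (- A)"
  have "open ?W"
    using assms unfolding case_prod_unfold
    by (intro open_vimage continuous_intros) (simp add: open_Compl)
  moreover have "{x} \<times> {-T..T} \<subseteq> ?W"
  proof
    fix z assume "z \<in> {x} \<times> {-T..T}"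
    then obtain s where s: "z = (x, s)" "s \<in> {-T..T}" by blast
    have "x - s \<cdot> p \<notin> A"
    proof
      assume "x - s \<cdot> p \<in> A"
      then have "(x - s \<cdot> p) + s \<cdot> p \<in> A + (\<lambda>s. s \<cdot> p) ` {-T..T}"
        using s(2) by (intro set_plus_intro) auto
      with x show False by simp
    qed
    then show "z \<in> ?W" using s(1) by simp
  qed
  ultimately obtain X where X: "x \<in> X" "open X" "X \<times> {-T..T} \<subseteq> ?W"
    using Elementary_Topology.tube_lemma[of "{-T..T}" ?W x] by auto
  have "X \<subseteq> - (A + (\<lambda>s. s \<cdot> p) ` {-T..T})"
  proof
    fix y assume y: "y \<in> X"
    show "y \<in> - (A + (\<lambda>s. s \<cdot> p) ` {-T..T})"
    proof
      assume "y \<in> A + (\<lambda>s. s \<cdot> p) ` {-T..T}"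
      then obtain a s where as: "a \<in> A" "s \<in> {-T..T}" "y = a + s \<cdot> p"
        by (auto simp: set_plus_def)
      then have "(y, s) \<in> ?W" using X(3) y by blast
      then show False using as by simp
    qed
  qed
  then show "\<exists>X. open X \<and> x \<in> X \<and> X \<subseteq> - (A + (\<lambda>s. s \<cdot> p) ` {-T..T})"
    using X by blast
qed

text \<open>Since \<open>A\<close> is closed and misses \<open>t \<cdot> p\<close>, points of
  \<open>A + line p\<close> near 0 have coefficients along \<open>p\<close> bounded by
  \<open>\<bar>t\<bar>\<close>. Passing to the closure then costs nothing, as the sum with a segment
  is closed.\<close>

lemma closure_plus_line_near_0:
  assumes A: "disc A" "closed A" and t: "t \<cdot> p \<notin> A"
  shows "\<exists>G. disc_nhd G \<and> G \<inter> closure (A + line p) \<subseteq> A + (\<lambda>s. s \<cdot> p) ` {-\<bar>t\<bar>..\<bar>t\<bar>}"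
proof -
  let ?C = "A + (\<lambda>s. s \<cdot> p) ` {-\<bar>t\<bar>..\<bar>t\<bar>}"
  have "0 \<in> interior ((\<lambda>y. t \<cdot> p + y) -` (- A))"
    using A(2) t by (intro interior_vimage continuous_on_add_left) (auto simp: interior_open open_Compl)
  then obtain G0 where G0: "disc_nhd G0" "G0 \<subseteq> (\<lambda>y. t \<cdot> p + y) -` (- A)"
    by (rule disc_nhd_subset)
  \<comment> \<open>If \<open>\<bar>s\<bar> > \<bar>t\<bar>\<close>, multiplying
    \<open>a + s \<cdot> p\<close> by \<open>-t/s\<close> keeps it in \<open>G0\<close> and cancels
    \<open>t \<cdot> p\<close>, which leaves a point of \<open>A\<close> in the translate that
    avoids \<open>A\<close>.\<close>
  have small: "s \<in> {-\<bar>t\<bar>..\<bar>t\<bar>}" if a: "a \<in> A" "a + s \<cdot> p \<in> G0" for a s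
  proof (rule ccontr)
    assume "s \<notin> {-\<bar>t\<bar>..\<bar>t\<bar>}"
    then have s: "\<bar>s\<bar> > \<bar>t\<bar>" by auto
    then have ts: "\<bar>- (t/s)\<bar> \<le> 1" by (auto simp: abs_divide divide_le_eq_1)
    have "(- (t/s)) \<cdot> (a + s \<cdot> p) \<in> G0" using a ts by (intro disc_scale disc_nhd_disc G0)
    then have "t \<cdot> p + (- (t/s)) \<cdot> (a + s \<cdot> p) \<notin> A" using G0(2) by blast
    moreover have eq: "t \<cdot> p + (- (t/s)) \<cdot> (a + s \<cdot> p) = (- (t/s)) \<cdot> a"
      using s by (simp add: scale_right_distrib)
    have "t \<cdot> p + (- (t/s)) \<cdot> (a + s \<cdot> p) \<in> A"
      unfolding eq using a ts by (intro disc_scale A)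
    ultimately show False by blast
  qed
  obtain G where G: "disc_nhd G" "\<And>x y. x \<in> G \<Longrightarrow> y \<in> G \<Longrightarrow> x + y \<in> G0"
    using disc_nhd_half[OF G0(1)] by blast
  have "x \<in> ?C" if x: "x \<in> G" "x \<in> closure (A + line p)" for x
  proof -
    have "x \<in> closure ?C"
      unfolding closure_iff_disc_nhd
    proof (intro allI impI)
      fix H assume "disc_nhd H"
      then obtain y where y: "y \<in> A + line p" "y - x \<in> H \<inter> G"
        using closure_memD[OF x(2)] disc_nhd_Int G(1) by blast
      then obtain a s where as: "a \<in> A" "y = a + s \<cdot> p" by (auto simp: set_plus_def line_def)
      \<comment> \<open>Halving \<open>G0\<close> left room for both \<open>x\<close> and the error
        \<open>y - x\<close>.\<close>
      have "(y - x) + x \<in> G0" using y x by (intro G(2)) auto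
      then have "s \<in> {-\<bar>t\<bar>..\<bar>t\<bar>}" using small as by simp
      then have "y \<in> ?C" using as by (auto intro!: set_plus_intro)
      then show "\<exists>y\<in>?C. y - x \<in> H" using y by blast
    qed
    then show ?thesis using closed_plus_segment[OF A(2)] by simp
  qed
  then show ?thesis using G(1) by blast
qed

section \<open>Closed subspaces plus finite-dimensional ones\<close>

lemma subspace_plus: "subspace S \<Longrightarrow> subspace T \<Longrightarrow> subspace (S + T)"
  using subspace_sums[of S T] by (rule back_subst[of subspace]) (auto simp: set_plus_def)

lemma plus_span_insert: "A + span (insert p P) = (A + span P) + line p"
proof -
  have "span (insert p P) = span P + line p"
  proof (intro set_eqI iffI)
    fix x assume "x \<in> span (insert p P)"
    then obtain k where "x - k \<cdot> p \<in> span P" by (auto simp: span_breakdown_eq)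
    then have "(x - k \<cdot> p) + k \<cdot> p \<in> span P + line p" by (intro set_plus_intro) (auto simp: line_def)
    then show "x \<in> span P + line p" by simp
  next
    fix x assume "x \<in> span P + line p"
    then obtain y k where "y \<in> span P" "x = y + k \<cdot> p"
      by (auto simp: set_plus_def line_def)
    then show "x \<in> span (insert p P)"
      unfolding span_breakdown_eq by (intro exI[of _ k]) simp
  qed
  then show ?thesis by (simp add: add.assoc)
qed

text \<open>If \<open>p \<notin> S\<close>, the previous analysis with \<open>t = 1\<close> puts the
  closure of the sum inside the sum near 0; scaling extends this to all points, as both are
  subspaces.\<close>

lemma closed_plus_line:
  assumes S: "subspace S" "closed S"
  shows "closed (S + line p)"
proof (cases "p \<in> S")
  case True
  have "S + line p = S"
  proof
    show "S + line p \<subseteq> S"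
      using S(1) True by (auto simp: set_plus_def line_def intro!: subspace_add subspace_scale)
    show "S \<subseteq> S + line p"
      using subspace_0[OF subspace_line, of p] by (force simp: set_plus_def)
  qed
  then show ?thesis using S(2) by simp
next
  case False
  let ?L = "S + line p"
  have L: "subspace ?L" using S(1) subspace_line by (rule subspace_plus)
  obtain G where G: "disc_nhd G" "G \<inter> closure ?L \<subseteq> S + (\<lambda>s. s \<cdot> p) ` {-\<bar>1\<bar>..\<bar>1\<bar>}"
    using closure_plus_line_near_0[OF disc_subspace[OF S(1)] S(2), of 1 p] False by auto
  have "x \<in> ?L" if x: "x \<in> closure ?L" for x
  proof -
    obtain e where e: "e > 0" "e \<cdot> x \<in> G" by (rule absorbs_pos[OF G(1)])
    have "e \<cdot> x \<in> closure ?L" using subspace_closure[OF L] x by (rule subspace_scale)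
    then have "e \<cdot> x \<in> S + (\<lambda>s. s \<cdot> p) ` {-\<bar>1\<bar>..\<bar>1\<bar>}" using e G(2) by blast
    then have "e \<cdot> x \<in> ?L" by (auto simp: set_plus_def line_def)
    then have "(1/e) \<cdot> (e \<cdot> x) \<in> ?L" by (rule subspace_scale[OF L])
    then show ?thesis using e(1) by simp
  qed
  then have "closure ?L = ?L" using closure_subset by blast
  then show ?thesis by (simp add: closure_eq)
qed

lemma closed_plus_span:
  assumes "finite P" "subspace S" "closed S"
  shows "closed (S + span P)"
  using assms(1)
proof (induction P)
  case empty
  then show ?case using assms(3) by (simp add: set_plus_def)
next
  case (insert p P)
  then show ?case
    unfolding plus_span_insert using assms(2) by (intro closed_plus_line subspace_plus subspace_span)
qed

section \<open>Spans of discs and removal of finitely many dimensions\<close>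

lemma subspace_cone_of:
  assumes "disc A"
  shows "subspace (cone_of A)"
proof (rule subspaceI)
  show "0 \<in> cone_of A" using disc_0[OF assms] by (force simp: cone_of_def)
  show "c \<cdot> x \<in> cone_of A" if x: "x \<in> cone_of A" for c x
  proof -
    obtain r a where "a \<in> A" "x = r \<cdot> a" using x by (auto simp: cone_of_def)
    then have "c \<cdot> x = (c * r) \<cdot> a" "a \<in> A" by simp_all
    then show ?thesis unfolding cone_of_def by blast
  qed
  fix x y assume "x \<in> cone_of A" "y \<in> cone_of A"
  then obtain r a s b where ab: "x = r \<cdot> a" "y = s \<cdot> b" "a \<in> A" "b \<in> A"
    by (auto simp: cone_of_def)
  \<comment> \<open>The summand 1 keeps \<open>t\<close> positive when both coefficients
    vanish.\<close>
  define t where "t = \<bar>r\<bar> + \<bar>s\<bar> + 1"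
  have t: "t > 0" "\<bar>r\<bar> + \<bar>s\<bar> \<le> t" by (auto simp: t_def)
  have "\<bar>r/t\<bar> + \<bar>s/t\<bar> = (\<bar>r\<bar> + \<bar>s\<bar>) / t" using t(1) by (simp add: add_divide_distrib)
  also have "\<dots> \<le> 1" using t by simp
  finally have "(r/t) \<cdot> a + (s/t) \<cdot> b \<in> A" by (rule discD[OF assms ab(3,4)])
  moreover have "x + y = t \<cdot> ((r/t) \<cdot> a + (s/t) \<cdot> b)" using t ab by (simp add: scale_right_distrib)
  ultimately show "x + y \<in> cone_of A" unfolding cone_of_def by blast
qed

lemma subset_cone_of: "A \<subseteq> cone_of A"
proof
  fix x assume "x \<in> A"
  then have "1 \<cdot> x \<in> cone_of A" unfolding cone_of_def by blast
  then show "x \<in> cone_of A" by simp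
qed

lemma cone_of_mono: "A \<subseteq> B \<Longrightarrow> cone_of A \<subseteq> cone_of B"
  by (auto simp: cone_of_def)

text \<open>
  For \<open>A\<close> the image of a neighbourhood of \<open>0\<close> under a linear map, \<^term>\<open>cone_of A\<close> is the range of the map.
\<close>
definition almost_open :: "'a set \<Rightarrow> bool" where
  "almost_open A \<longleftrightarrow> (\<exists>G. disc_nhd G \<and> G \<inter> closure (cone_of A) \<subseteq> closure A)"

text \<open>If the whole line lies in \<open>B\<close>, adding it does not enlarge the closure.
  Otherwise points of \<open>L\<close> near 0 are of the form \<open>b + s \<cdot> p\<close> with
  \<open>b \<in> B\<close> and bounded \<open>s\<close>. If \<open>p\<close> is in the span of
  \<open>B\<close>, rescaling absorbs the bounded term; if not, \<open>p\<close> is outside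
  \<open>L\<close> and \<open>s\<close> must vanish.\<close>

lemma almost_open_line:
  assumes A: "disc A" and reg: "almost_open (A + line p)"
  shows "almost_open A"
proof -
  define B where "B = closure A"
  define L where "L = closure (cone_of A)"
  have B: "disc B" "closed B" unfolding B_def using A by (auto intro: disc_closure)
  have L: "subspace L" unfolding L_def using A by (intro subspace_closure subspace_cone_of)
  have AB: "A \<subseteq> B" unfolding B_def by (rule closure_subset)
  have BL: "B \<subseteq> L" unfolding B_def L_def by (intro closure_mono subset_cone_of)
  have "A \<subseteq> A + line p"
    using subspace_0[OF subspace_line, of p] by (force simp: set_plus_def)
  then have AL: "L \<subseteq> closure (cone_of (A + line p))"
    unfolding L_def by (intro closure_mono cone_of_mono)
  have "\<exists>G. disc_nhd G \<and> G \<inter> closure (cone_of (A + line p)) \<subseteq> closure (A + line p)"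
    using reg by (simp add: almost_open_def)
  then obtain G where G: "disc_nhd G" "G \<inter> L \<subseteq> closure (A + line p)" using AL by blast
  show ?thesis
  proof (cases "\<forall>t. t \<cdot> p \<in> B")
    case True
    \<comment> \<open>As \<open>d\<close> tends to 0, \<open>a + t \<cdot> p\<close> is the limit of
      \<open>(1 - d) \<cdot> a + t \<cdot> p\<close>, a combination of \<open>a\<close> and the
      point \<open>(t/d) \<cdot> p\<close> of \<open>B\<close>.\<close>
    have "A + line p \<subseteq> B"
    proof
      fix x assume "x \<in> A + line p"
      then obtain a t where x: "a \<in> A" "x = a + t \<cdot> p" by (auto simp: set_plus_def line_def)
      have "x \<in> closure B"
        unfolding closure_iff_disc_nhd
      proof (intro allI impI)
        fix H assume H: "disc_nhd H"
        obtain e where e: "e > 0" "\<And>r. \<bar>r\<bar> \<le> e \<Longrightarrow> r \<cdot> a \<in> H" using absorbs[OF H, of a] by blast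
        define d where "d = min e 1"
        have d: "d > 0" "d \<le> 1" "d \<le> e" using e by (auto simp: d_def)
        have "(1 - d) \<cdot> a + d \<cdot> ((t/d) \<cdot> p) \<in> B"
          using x(1) AB d True by (intro discD[OF B(1)]) auto
        moreover have "(1 - d) \<cdot> a + d \<cdot> ((t/d) \<cdot> p) - x = (- d) \<cdot> a"
          using d x by (simp add: algebra_simps scale_left_diff_distrib)
        moreover have "(- d) \<cdot> a \<in> H" using d by (intro e(2)) auto
        ultimately show "\<exists>y\<in>B. y - x \<in> H" by metis
      qed
      then show "x \<in> B" using B(2) by simp
    qed
    then have "closure (A + line p) \<subseteq> B" using B(2) by (rule closure_minimal)
    then have "G \<inter> closure (cone_of A) \<subseteq> closure A" using G(2) unfolding B_def L_def by blast
    then show ?thesis using G(1) unfolding almost_open_def by blast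
  next
    case False
    then obtain t where t: "t \<cdot> p \<notin> B" by blast
    let ?D = "(\<lambda>s. s \<cdot> p) ` {-\<bar>t\<bar>..\<bar>t\<bar>}"
    obtain G1 where G1: "disc_nhd G1" "G1 \<inter> closure (B + line p) \<subseteq> B + ?D"
      using closure_plus_line_near_0[OF B t] by blast
    let ?G = "G \<inter> G1"
    have nd: "disc_nhd ?G" using G(1) G1(1) by (rule disc_nhd_Int)
    have "closure (A + line p) \<subseteq> closure (B + line p)"
      using AB by (intro closure_mono set_plus_mono2) auto
    then have BD: "?G \<inter> L \<subseteq> B + ?D" using G(2) G1(2) by blast
    have in_BD: "\<exists>b s. b \<in> B \<and> \<bar>s\<bar> \<le> \<bar>t\<bar> \<and> x = b + s \<cdot> p" if "x \<in> ?G" "x \<in> L" for x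
    proof -
      have "x \<in> B + ?D" using BD that by blast
      then obtain b s where "b \<in> B" "s \<in> {-\<bar>t\<bar>..\<bar>t\<bar>}" "x = b + s \<cdot> p"
        by (auto simp: set_plus_def)
      then show ?thesis by (intro exI[of _ b] exI[of _ s]) auto
    qed
    show ?thesis
    proof (cases "p \<in> cone_of B")
      case True
      then obtain r b where b: "p = r \<cdot> b" "b \<in> B" by (auto simp: cone_of_def)
      \<comment> \<open>With \<open>p = r \<cdot> b\<close>, this factor makes the coefficients of
        \<open>m \<cdot> (b' + s \<cdot> p)\<close> with respect to \<open>b'\<close> and
        \<open>b\<close> have absolute sum at most 1.\<close>
      define m where "m = 1 / (1 + \<bar>t\<bar> * \<bar>r\<bar>)"
      have pos: "1 + \<bar>t\<bar> * \<bar>r\<bar> > 0" by (simp add: add_pos_nonneg)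
      then have m: "m > 0" by (simp add: m_def)
      have mB: "m \<cdot> x \<in> B" if x: "x \<in> ?G" "x \<in> L" for x
      proof -
        obtain b' s where bs: "b' \<in> B" "\<bar>s\<bar> \<le> \<bar>t\<bar>" "x = b' + s \<cdot> p"
          using in_BD[OF x] by blast
        have "\<bar>m\<bar> + \<bar>m * s * r\<bar> = m * (1 + \<bar>s\<bar> * \<bar>r\<bar>)"
          using m by (simp add: abs_mult algebra_simps)
        also have "\<dots> \<le> m * (1 + \<bar>t\<bar> * \<bar>r\<bar>)"
          using m bs(2) by (intro mult_left_mono add_left_mono mult_right_mono) auto
        also have "\<dots> = 1" using pos by (simp add: m_def)
        finally have "m \<cdot> b' + (m * s * r) \<cdot> b \<in> B" by (rule discD[OF B(1) bs(1) b(2)])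
        then show ?thesis using bs(3) b(1) by (simp add: scale_right_distrib mult.assoc)
      qed
      have "disc_nhd ((\<cdot>) m ` ?G)" using nd m by (intro disc_nhd_scaled) auto
      moreover have "(\<cdot>) m ` ?G \<inter> L \<subseteq> B"
      proof
        fix y assume "y \<in> (\<cdot>) m ` ?G \<inter> L"
        then obtain x where x: "x \<in> ?G" "y = m \<cdot> x" "y \<in> L" by blast
        have "(1/m) \<cdot> y \<in> L" using L x(3) by (rule subspace_scale)
        then have "x \<in> L" using x(2) m by simp
        then show "y \<in> B" using mB x by blast
      qed
      ultimately show ?thesis unfolding almost_open_def B_def L_def by blast
    next
      case p: False
      \<comment> \<open>A point of the span close to \<open>p\<close> differs from it by an element of \<open>e (B + ?D)\<close>. As
        \<open>e \<bar>t\<bar> < 1\<close>, the equation can be solved for \<open>p\<close>, which puts \<open>p\<close> into \<^term>\<open>cone_of B\<close>.\<close>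
      have notL: "p \<notin> L"
      proof
        assume pL: "p \<in> L"
        define e where "e = 1 / (1 + \<bar>t\<bar>)"
        have pos: "1 + \<bar>t\<bar> > 0" by (simp add: add_pos_nonneg)
        then have e: "e > 0" by (simp add: e_def)
        obtain l where l: "l \<in> cone_of A" "l - p \<in> (\<cdot>) e ` ?G"
          using closure_memD[OF pL[unfolded L_def] disc_nhd_scaled[OF nd, of e]] e by auto
        then obtain x where x: "x \<in> ?G" "l - p = e \<cdot> x" by blast
        have "l \<in> L" using l(1) closure_subset unfolding L_def by blast
        then have "l - p \<in> L" using pL by (rule subspace_diff[OF L])
        then have "(1/e) \<cdot> (l - p) \<in> L" by (rule subspace_scale[OF L])
        then have "x \<in> L" using x(2) e by simp
        then obtain b' s where bs: "b' \<in> B" "\<bar>s\<bar> \<le> \<bar>t\<bar>" "x = b' + s \<cdot> p"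
          using in_BD[OF x(1)] by blast
        have cB: "subspace (cone_of B)" using B(1) by (rule subspace_cone_of)
        have "(1 + e * s) \<cdot> p = p + e \<cdot> (s \<cdot> p)"
          by (simp add: scale_left_distrib)
        also have "\<dots> = l - e \<cdot> b'"
          using x(2) bs(3) by (simp add: scale_right_distrib algebra_simps)
        also have "\<dots> \<in> cone_of B"
          using l(1) cone_of_mono[OF AB] bs(1) subset_cone_of[of B]
          by (intro subspace_diff[OF cB] subspace_scale[OF cB]) auto
        finally have "(1 / (1 + e * s)) \<cdot> ((1 + e * s) \<cdot> p) \<in> cone_of B"
          by (rule subspace_scale[OF cB])
        moreover have "\<bar>e * s\<bar> < 1"
          using e bs(2) pos by (simp add: e_def abs_mult)
        then have "1 + e * s \<noteq> 0" by linarith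
        ultimately show False using p by simp
      qed
      \<comment> \<open>Both \<open>x\<close> and \<open>b'\<close> lie in the subspace
        \<open>L\<close>, hence so does \<open>s \<cdot> p\<close>, and \<open>p \<notin> L\<close>
        forces \<open>s = 0\<close>.\<close>
      have "?G \<inter> L \<subseteq> B"
      proof
        fix x assume x: "x \<in> ?G \<inter> L"
        then obtain b' s where bs: "b' \<in> B" "x = b' + s \<cdot> p"
          using in_BD[of x] by blast
        have "x - b' \<in> L" using x bs BL by (intro subspace_diff[OF L]) auto
        then have "s \<cdot> p \<in> L" using bs(2) by simp
        then have "(1/s) \<cdot> (s \<cdot> p) \<in> L" by (rule subspace_scale[OF L])
        then have "s = 0" using notL by (cases "s = 0") auto
        then show "x \<in> B" using bs by simp
      qed
      then show ?thesis using nd unfolding almost_open_def B_def L_def by blast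
    qed
  qed
qed

lemma almost_open_span:
  assumes "finite P" "disc A" "almost_open (A + span P)"
  shows "almost_open A"
  using assms(1,3)
proof (induction P)
  case empty
  then show ?case by (simp add: set_plus_def)
next
  case (insert p P)
  have "disc (A + span P)"
    by (intro disc_plus assms(2) disc_subspace subspace_span)
  then have "almost_open (A + span P)"
    using insert.prems unfolding plus_span_insert by (rule almost_open_line)
  then show ?case by (rule insert.IH)
qed

text \<open>Compact sets are bounded: the dilates of the interior of \<open>G\<close> by powers of 2
  are an open cover, and balancedness lets the largest index of a finite subcover serve all
  points.\<close>

lemma compact_absorbed:
  assumes K: "compact K" and G: "disc_nhd G"
  shows "\<exists>n. \<forall>x\<in>K. (1/2) ^ n \<cdot> x \<in> G"
proof -
  let ?V = "\<lambda>n::nat. (\<lambda>x. (1/2) ^ n \<cdot> x) -` interior G"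
  have sc: "(1/2) ^ N \<cdot> x \<in> G" if x: "(1/2) ^ n \<cdot> x \<in> G" and "n \<le> N" for n N :: nat and x
    using \<open>n \<le> N\<close>
  proof (induction N rule: dec_induct)
    case (step m)
    have "(1/2) \<cdot> ((1/2) ^ m \<cdot> x) \<in> G"
      by (rule disc_scale[OF disc_nhd_disc[OF G] step.IH]) simp
    then show ?case by simp
  qed (fact x)
  have opn: "open (?V n)" for n
    by (intro open_vimage continuous_intros open_interior)
  have cover: "K \<subseteq> (\<Union>n. ?V n)"
  proof
    fix x
    have "0 \<in> interior (interior G)" using G by (simp add: disc_nhd_def)
    then obtain G' where G': "disc_nhd G'" "G' \<subseteq> interior G" by (rule disc_nhd_subset)
    obtain e where e: "e > 0" "\<And>r. \<bar>r\<bar> \<le> e \<Longrightarrow> r \<cdot> x \<in> G'" using absorbs[OF G'(1), of x] by blast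
    obtain n where n: "(1/2::real) ^ n < e" using real_arch_pow_inv[OF e(1), of "1/2"] by auto
    then have "(1/2) ^ n \<cdot> x \<in> G'" by (intro e(2)) (simp add: abs_of_nonneg)
    then have "(1/2) ^ n \<cdot> x \<in> interior G" using G'(2) by blast
    then show "x \<in> (\<Union>n. ?V n)" by blast
  qed
  obtain C where C: "finite C" "K \<subseteq> (\<Union>n\<in>C. ?V n)"
    by (rule compactE_image[OF K opn cover])
  have "(1/2) ^ Max (insert 0 C) \<cdot> x \<in> G" if x: "x \<in> K" for x
  proof -
    obtain n where n: "n \<in> C" "(1/2) ^ n \<cdot> x \<in> interior G" using C(2) x by blast
    have "(1/2) ^ n \<cdot> x \<in> G" using n(2) interior_subset by blast
    moreover have "n \<le> Max (insert 0 C)" using C(1) n(1) by simp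
    ultimately show ?thesis by (rule sc)
  qed
  then show ?thesis by blast
qed

end

section \<open>Almost open maps\<close>

locale frechet_map = E: real_frechet sE + F: real_frechet sF
  for sE :: "real \<Rightarrow> 'e::{uniform_topological_group_add, ab_group_add} \<Rightarrow> 'e"
    and sF :: "real \<Rightarrow> 'f::{uniform_topological_group_add, ab_group_add} \<Rightarrow> 'f" +
  fixes h :: "'e \<Rightarrow> 'f"
  assumes linear: "Vector_Spaces.linear sE sF h"
    and continuous: "continuous_on UNIV h"
begin

sublocale linear: Vector_Spaces.linear sE sF h
  by (fact linear)

lemma disc_image:
  assumes "E.disc W"
  shows "F.disc (h ` W)"
  unfolding F.disc_def
proof (intro conjI ballI allI impI)
  show "0 \<in> h ` W" using E.disc_0[OF assms] linear.zero by force
  fix x y u v assume "x \<in> h ` W" "y \<in> h ` W" and uv: "\<bar>u\<bar> + \<bar>v\<bar> \<le> (1::real)"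
  then obtain a b where "x = h a" "y = h b" "a \<in> W" "b \<in> W" by auto
  then show "sF u x + sF v y \<in> h ` W"
    using E.discD[OF assms _ _ uv, of a b]
    by (intro image_eqI[of _ _ "sE u a + sE v b"]) (auto simp: linear.add linear.scale)
qed

lemma disc_nhd_vimage: "F.disc_nhd G \<Longrightarrow> E.disc_nhd (h -` G)"
  unfolding E.disc_nhd_def F.disc_nhd_def E.disc_def F.disc_def
  by (auto simp: linear.add linear.scale linear.zero intro!: interior_vimage continuous)

lemma subspace_range: "F.subspace (range h)"
  using linear.subspace_image[of UNIV] E.subspace_UNIV by simp

text \<open>The successive approximation of the open mapping theorem, relative to the closure of the
  range: residuals stay in this closed subspace, so each can be approximated from the next smaller
  image.\<close>

lemma open_onto_closure:
  assumes almost: "\<And>W. E.disc_nhd W \<Longrightarrow>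
      \<exists>G. F.disc_nhd G \<and> G \<inter> closure (range h) \<subseteq> closure (h ` W)"
    and W0: "E.disc_nhd W0"
  shows "\<exists>G. F.disc_nhd G \<and> G \<inter> closure (range h) \<subseteq> h ` W0"
proof -
  \<comment> \<open>The factor \<open>1/3\<close> compensates the one in
    \<open>summable_steps\<close>, so that the limit ends up in \<open>W0\<close> itself.\<close>
  have "E.disc_nhd (sE (1/3) ` W0)" using W0 by (intro E.disc_nhd_scaled) auto
  then obtain W where W: "E.halving_base W" "W 0 \<subseteq> sE (1/3) ` W0"
    by (rule E.halving_base_exists)
  obtain V where V: "F.halving_base V"
    using F.halving_base_exists[OF F.disc_nhd_UNIV] by blast
  \<comment> \<open>Containment in \<open>V n\<close> makes the residuals tend to 0.\<close>
  have "\<exists>G. F.disc_nhd G \<and> G \<inter> closure (range h) \<subseteq> closure (h ` W n) \<and> G \<subseteq> V n" for n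
    proof -
    obtain H where "F.disc_nhd H" "H \<inter> closure (range h) \<subseteq> closure (h ` W n)"
      using almost[OF E.halving_base_nhd[OF W(1)]] by blast
    then show ?thesis
      using F.disc_nhd_Int[OF _ F.halving_base_nhd[OF V], of H n] by (intro exI[of _ "H \<inter> V n"]) auto
  qed
  then obtain G where G: "\<And>n. F.disc_nhd (G n)" "\<And>n. G n \<inter> closure (range h) \<subseteq> closure (h ` W n)"
      "\<And>n. G n \<subseteq> V n" by metis
  have cl: "F.subspace (closure (range h))" using subspace_range by (rule F.subspace_closure)
  have "y \<in> h ` W0" if y: "y \<in> G 0 \<inter> closure (range h)" for y
  proof -
    \<comment> \<open>\<open>s n\<close> is the \<open>n\<close>-th approximate preimage of
      \<open>y\<close>. The clause for \<open>n = 0\<close> records the starting value in a form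
      that dependent choice can carry.\<close>
    have "\<exists>s. \<forall>n. (y - h (s n) \<in> G n \<and> (n = 0 \<longrightarrow> s n = 0)) \<and> s (Suc n) - s n \<in> W n"
    proof (rule dependent_nat_choice)
      show "\<exists>x. y - h x \<in> G 0 \<and> (0 = (0::nat) \<longrightarrow> x = 0)" using y linear.zero by auto
      fix s n assume s: "y - h s \<in> G n \<and> (n = 0 \<longrightarrow> s = 0)"
      have "y - h s \<in> closure (range h)"
        using y closure_subset[of "range h"] by (intro F.subspace_diff[OF cl]) auto
      then have "y - h s \<in> closure (h ` W n)" using G(2) s by blast
      then obtain w where w: "w \<in> W n" "h w - (y - h s) \<in> G (Suc n)"
        using F.closure_memD[OF _ G(1)] by blast
      have "y - h (s + w) \<in> G (Suc n)"
        using F.disc_uminus[OF F.disc_nhd_disc[OF G(1)] w(2)] by (simp add: linear.add algebra_simps)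
      then show "\<exists>t. (y - h t \<in> G (Suc n) \<and> (Suc n = 0 \<longrightarrow> t = 0)) \<and> t - s \<in> W n"
        using w(1) by (intro exI[of _ "s + w"]) auto
    qed
    then obtain s where s: "\<forall>n. (y - h (s n) \<in> G n \<and> (n = 0 \<longrightarrow> s n = 0)) \<and> s (Suc n) - s n \<in> W n"
      by blast
    then have s1: "y - h (s n) \<in> G n" and s0: "s 0 = 0" and step: "s (Suc n) - s n \<in> W n" for n
      by simp_all
    obtain x where x: "\<forall>G. E.disc_nhd G \<longrightarrow> (\<exists>N. \<forall>n\<ge>N. s n - x \<in> G)"
      and x0: "\<forall>n. sE (1/3) (x - s n) \<in> W n"
      using E.summable_steps[OF W(1) step] by auto
    have "y - h x = 0"
    proof (rule F.eq_0_if_in_all_nhds)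
      fix H assume "F.disc_nhd H"
      \<comment> \<open>\<open>y - h x\<close> splits into the residual \<open>y - h (s n)\<close>
        and \<open>h (s n - x)\<close>, both small for large \<open>n\<close>.\<close>
      then obtain H' where H': "F.disc_nhd H'" "\<And>a b. a \<in> H' \<Longrightarrow> b \<in> H' \<Longrightarrow> a + b \<in> H"
        using F.disc_nhd_half by blast
      obtain N where N: "\<And>n. n \<ge> N \<Longrightarrow> h (s n - x) \<in> H'"
        using x disc_nhd_vimage[OF H'(1)] by (metis vimage_eq)
      obtain m where m: "V m \<subseteq> H'" by (rule F.halving_base_subset[OF V H'(1)])
      let ?n = "max m N"
      have "y - h (s ?n) \<in> H'" using s1[of ?n] G(3)[of ?n] F.halving_base_antimono[OF V, of m ?n] m by auto
      then have "(y - h (s ?n)) + h (s ?n - x) \<in> H" by (intro H'(2) N) auto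
      then show "y - h x \<in> H" by (simp add: linear.diff)
    qed
    moreover have "sE (1/3) x \<in> sE (1/3) ` W0" using spec[OF x0, of 0] s0 W(2) by auto
    then have "x \<in> W0" by auto
    ultimately show ?thesis by auto
  qed
  then show ?thesis using G(1) by blast
qed

text \<open>Applied to the whole space, \<open>open_onto_closure\<close> puts the closure of the
  range inside the range near 0; scaling does the rest.\<close>

lemma closed_range_if_almost_open:
  assumes "\<And>W. E.disc_nhd W \<Longrightarrow> \<exists>G. F.disc_nhd G \<and> G \<inter> closure (range h) \<subseteq> closure (h ` W)"
  shows "closed (range h)"
proof -
  obtain G where G: "F.disc_nhd G" "G \<inter> closure (range h) \<subseteq> range h"
    using open_onto_closure[OF assms E.disc_nhd_UNIV] by blast
  have "x \<in> range h" if x: "x \<in> closure (range h)" for x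
  proof -
    obtain e where e: "e > 0" "sF e x \<in> G"
      by (rule F.absorbs_pos[OF G(1)])
    have "sF e x \<in> closure (range h)"
      using F.subspace_closure[OF subspace_range] x by (rule F.subspace_scale)
    then have "sF e x \<in> range h" using G(2) e(2) by blast
    then have "sF (1/e) (sF e x) \<in> range h" by (rule F.subspace_scale[OF subspace_range])
    then show ?thesis using e(1) by simp
  qed
  then have "closure (range h) = range h" using closure_subset by blast
  then show ?thesis by (simp add: closure_eq)
qed

lemma open_mapping:
  assumes "surj h" and W: "E.disc_nhd W"
  shows "0 \<in> interior (h ` W)"
proof -
  have "\<exists>G. F.disc_nhd G \<and> G \<inter> closure (range h) \<subseteq> closure (h ` W)" if W: "E.disc_nhd W" for W
  proof -
    have "0 \<in> interior (closure (h ` W))"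
    proof (rule F.barrel_nhd)
      show "F.disc (closure (h ` W))"
        using W by (intro F.disc_closure disc_image E.disc_nhd_disc)
      fix y
      obtain x where x: "y = h x" using assms(1) by auto
      obtain e where "e > 0" "sE e x \<in> W"
        by (rule E.absorbs_pos[OF W])
      then show "\<exists>r. r \<noteq> 0 \<and> sF r y \<in> closure (h ` W)"
        using x closure_subset[of "h ` W"] by (intro exI[of _ e]) (auto simp flip: linear.scale)
    qed auto
    then obtain G where "F.disc_nhd G" "G \<subseteq> closure (h ` W)" by (rule F.disc_nhd_subset)
    then show ?thesis by blast
  qed
  then have "\<exists>G. F.disc_nhd G \<and> G \<inter> closure (range h) \<subseteq> h ` W"
    using W by (rule open_onto_closure)
  then obtain G where "0 \<in> interior G" "G \<subseteq> h ` W"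
    using assms(1) by (auto simp: F.disc_nhd_def)
  then show ?thesis using interior_mono[of G "h ` W"] by blast
qed

end

section \<open>Compact perturbations\<close>

locale compact_perturbation = f: frechet_map sE sF f + g: frechet_map sE sF g
  for sE :: "real \<Rightarrow> 'e::{uniform_topological_group_add, ab_group_add} \<Rightarrow> 'e"
    and sF :: "real \<Rightarrow> 'f::{uniform_topological_group_add, ab_group_add} \<Rightarrow> 'f"
    and f g :: "'e \<Rightarrow> 'f" +
  fixes U :: "'e set"
  assumes surj_g: "surj g"
    and nhd_U: "f.E.disc_nhd U"
    and compact: "compact (closure (f ` U))"
begin

abbreviation h :: "'e \<Rightarrow> 'f" where
  "h x \<equiv> f x + g x"

sublocale h: frechet_map sE sF h
proof
  show "\<And>x y. h (x + y) = h x + h y"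
    by (simp add: f.linear.add g.linear.add)
  show "\<And>c x. h (sE c x) = sF c (h x)"
    by (simp add: f.linear.scale g.linear.scale f.F.scale_right_distrib)
  show "continuous_on UNIV h"
    by (intro continuous_intros f.continuous g.continuous)
qed

text \<open>Modulo a finite-dimensional space each point of \<open>K\<close> is half of some
  \<open>g w\<close>. Since \<open>g w = h w - f w\<close> and \<open>- f w\<close> lies in
  \<open>K\<close> again, the approximation can be iterated, and each round halves the
  remainder.\<close>

lemma closure_image_plus_span_nhd:
  assumes W: "f.E.disc_nhd W" "W \<subseteq> U"
  shows "\<exists>P. finite P \<and> 0 \<in> interior (closure (h ` W + f.F.span P))"
proof -
  define K where "K = closure (f ` U)"
  have dW: "f.E.disc W" using W(1) by (rule f.E.disc_nhd_disc)
  have K: "compact K" "f.F.disc K"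
    unfolding K_def
    by (rule compact, intro f.F.disc_closure f.disc_image f.E.disc_nhd_disc nhd_U)
  have fW: "f w \<in> K" if "w \<in> W" for w
    using that W(2) closure_subset unfolding K_def by blast
  have nhd_gW: "0 \<in> interior (g ` W)" using surj_g W(1) by (rule g.open_mapping)
  let ?V = "\<lambda>b. (\<lambda>x. sF 2 (x - b)) -` interior (g ` W)"
  have opn: "open (?V b)" for b
    by (intro open_vimage open_interior f.F.continuous_on_scale continuous_intros)
  have cover: "K \<subseteq> (\<Union>b\<in>K. ?V b)"
  proof
    fix x assume "x \<in> K"
    moreover have "x \<in> ?V x" using nhd_gW by simp
    ultimately show "x \<in> (\<Union>b\<in>K. ?V b)" by blast
  qed
  obtain P where P: "finite P" "K \<subseteq> (\<Union>b\<in>P. ?V b)"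
    by (rule compactE_image[OF K(1) opn cover])
  let ?N = "f.F.span P"
  have half: "\<exists>b\<in>P. \<exists>w\<in>W. x = b + sF (1/2) (g w)" if x: "x \<in> K" for x
  proof -
    obtain b where b: "b \<in> P" "x \<in> ?V b" using P(2) x by blast
    then have "sF 2 (x - b) \<in> g ` W" using interior_subset by blast
    then obtain w where w: "w \<in> W" "sF 2 (x - b) = g w" by blast
    have "sF (1/2) (g w) = x - b" unfolding w(2)[symmetric] by simp
    then have "x = b + sF (1/2) (g w)" by simp
    then show ?thesis using b(1) w(1) by blast
  qed
  have approx: "\<exists>p\<in>?N. \<exists>w\<in>W. \<exists>k\<in>K. x = p + h w + sF ((1/2) ^ n) k" if "x \<in> K" for x n
    using that
  proof (induction n arbitrary: x)
    case 0
    have "x = 0 + h 0 + sF ((1/2) ^ 0) x"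
      by (simp add: f.linear.zero g.linear.zero)
    then show ?case
      using 0 f.E.disc_0[OF dW] f.F.span_zero by blast
  next
    case (Suc n)
    obtain b w where b: "b \<in> P" "w \<in> W" "x = b + sF (1/2) (g w)" using half[OF Suc.prems] by blast
    \<comment> \<open>The induction hypothesis is applied to \<open>- f w\<close>, not to
      \<open>x\<close>; the factor \<open>1/2\<close> in front of \<open>g w\<close> then turns
      \<open>(1/2)^n\<close> into the next power.\<close>
    have "- f w \<in> K" by (intro f.F.disc_uminus[OF K(2)] fW b(2))
    then obtain p w' k where k: "p \<in> ?N" "w' \<in> W" "k \<in> K" "- f w = p + h w' + sF ((1/2) ^ n) k"
      using Suc.IH by blast
    have gw: "g w = h w + (p + h w' + sF ((1/2) ^ n) k)"
      unfolding k(4)[symmetric] by simp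
    let ?p = "b + sF (1/2) p" and ?w = "sE (1/2) w + sE (1/2) w'"
    have hw: "h ?w = sF (1/2) (h w) + sF (1/2) (h w')"
      by (simp only: h.linear.add h.linear.scale)
    have k2: "sF ((1/2) ^ Suc n) k = sF (1/2) (sF ((1/2) ^ n) k)" by simp
    have "x = b + sF (1/2) (h w + (p + h w' + sF ((1/2) ^ n) k))"
      by (subst gw[symmetric]) (fact b(3))
    then have "x = ?p + h ?w + sF ((1/2) ^ Suc n) k"
      unfolding hw k2 by (simp only: f.F.scale_right_distrib add.assoc add.left_commute)
    moreover have "?p \<in> ?N"
      by (intro f.F.span_add f.F.span_scale f.F.span_base b(1) k(1))
    moreover have "?w \<in> W" by (rule f.E.discD[OF dW b(2) k(2)]) simp
    ultimately show ?case using k(3) by blast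
  qed
  let ?C = "closure (h ` W + ?N)"
  have dC: "f.F.disc ?C"
    by (intro f.F.disc_closure f.F.disc_plus h.disc_image dW f.F.disc_subspace f.F.subspace_span)
  have KC: "K \<subseteq> ?C"
  proof
    fix x assume x: "x \<in> K"
    show "x \<in> ?C"
      unfolding f.F.closure_iff_disc_nhd
    proof (intro allI impI)
      fix G assume G: "f.F.disc_nhd G"
      obtain n where n: "\<forall>k\<in>K. sF ((1/2) ^ n) k \<in> G"
        using f.F.compact_absorbed[OF K(1) G] by blast
      obtain p w k where k: "p \<in> ?N" "w \<in> W" "k \<in> K" "x = p + h w + sF ((1/2) ^ n) k"
        using approx[OF x] by blast
      have "h w + p \<in> h ` W + ?N" using k by (intro set_plus_intro) auto
      moreover have eq: "(h w + p) - x = - sF ((1/2) ^ n) k"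
        unfolding k(4) by (simp add: algebra_simps)
      have "(h w + p) - x \<in> G"
        unfolding eq using n k(3) by (intro f.F.disc_uminus[OF f.F.disc_nhd_disc[OF G]]) blast
      ultimately show "\<exists>y\<in>h ` W + ?N. y - x \<in> G" by blast
    qed
  qed
  \<comment> \<open>Half of \<open>g w\<close> equals half of \<open>h w\<close> minus half of
    \<open>f w\<close>, a disc combination of two points of \<open>?C\<close>.\<close>
  have "sF (1/2) ` g ` W \<subseteq> ?C"
  proof
    fix y assume "y \<in> sF (1/2) ` g ` W"
    then obtain w where w: "w \<in> W" "y = sF (1/2) (g w)" by blast
    have "h w + 0 \<in> h ` W + ?N" using w(1) f.F.span_zero by (intro set_plus_intro) auto
    then have hw: "h w \<in> ?C" using closure_subset by auto
    have "sF (1/2) (h w) + sF (-1/2) (f w) \<in> ?C"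
      by (rule f.F.discD[OF dC hw]) (use KC fW[OF w(1)] in auto)
    then show "y \<in> ?C" by (simp add: w(2) f.F.scale_right_distrib)
  qed
  moreover have "0 \<in> interior (sF (1/2) ` g ` W)"
    using nhd_gW by (intro f.F.nhd_scale) auto
  ultimately have "0 \<in> interior ?C" using interior_mono by blast
  then show ?thesis using P(1) by blast
qed

text \<open>The finite-dimensional summand varies with the neighbourhood, so it is removed by
  \<open>almost_open_span\<close> for each neighbourhood separately.\<close>

lemma closed_range: "closed (range h)"
proof (rule h.closed_range_if_almost_open)
  fix W0 assume W0: "f.E.disc_nhd W0"
  define W where "W = W0 \<inter> U"
  have W: "f.E.disc_nhd W" "W \<subseteq> U" "W \<subseteq> W0"
    unfolding W_def using f.E.disc_nhd_Int[OF W0 nhd_U] by auto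
  obtain P where P: "finite P" "0 \<in> interior (closure (h ` W + f.F.span P))"
    using closure_image_plus_span_nhd[OF W(1,2)] by blast
  have dW: "f.F.disc (h ` W)" by (intro h.disc_image f.E.disc_nhd_disc W)
  \<comment> \<open>This closure can itself serve as the witness for almost openness of the
    sum.\<close>
  have "f.F.disc_nhd (closure (h ` W + f.F.span P))"
    unfolding f.F.disc_nhd_def
    by (intro conjI P(2) f.F.disc_closure f.F.disc_plus dW f.F.disc_subspace f.F.subspace_span)
  then have "f.F.almost_open (h ` W + f.F.span P)"
    unfolding f.F.almost_open_def by blast
  then have "f.F.almost_open (h ` W)" by (rule f.F.almost_open_span[OF P(1) dW])
  then obtain G where G: "f.F.disc_nhd G" "G \<inter> closure (f.F.cone_of (h ` W)) \<subseteq> closure (h ` W)"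
    unfolding f.F.almost_open_def by blast
  \<comment> \<open>\<open>W\<close> absorbs every point, so its image spans the range.\<close>
  have "range h \<subseteq> f.F.cone_of (h ` W)"
  proof
    fix y assume "y \<in> range h"
    then obtain x where x: "y = h x" by blast
    obtain e where e: "e > 0" "sE e x \<in> W" by (rule f.E.absorbs_pos[OF W(1)])
    have "y = sF (1/e) (h (sE e x))" using e(1) x by (simp add: h.linear.scale)
    then show "y \<in> f.F.cone_of (h ` W)" unfolding f.F.cone_of_def using e(2) by blast
  qed
  then have "closure (range h) \<subseteq> closure (f.F.cone_of (h ` W))" by (rule closure_mono)
  moreover have "closure (h ` W) \<subseteq> closure (h ` W0)" using W(3) by (intro closure_mono image_mono)
  ultimately show "\<exists>G. f.F.disc_nhd G \<and> G \<inter> closure (range h) \<subseteq> closure (h ` W0)"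
    using G by blast
qed

text \<open>The sum is closed because the range is, so it contains a neighbourhood of 0, and a
  subspace doing so is the whole space.\<close>

lemma finite_complement: "\<exists>P. finite P \<and> range h + f.F.span P = UNIV"
proof -
  obtain P where P: "finite P" "0 \<in> interior (closure (h ` U + f.F.span P))"
    using closure_image_plus_span_nhd[OF nhd_U order_refl] by blast
  let ?S = "range h + f.F.span P"
  have S: "f.F.subspace ?S" by (intro f.F.subspace_plus h.subspace_range f.F.subspace_span)
  have "closed ?S" by (intro f.F.closed_plus_span P(1) h.subspace_range closed_range)
  then have "closure (h ` U + f.F.span P) \<subseteq> ?S"
    by (intro closure_minimal set_plus_mono2) auto
  then have "0 \<in> interior ?S" using P(2) interior_mono by blast
  then obtain G where G: "f.F.disc_nhd G" "G \<subseteq> ?S" by (rule f.F.disc_nhd_subset)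
  have "x \<in> ?S" for x
  proof -
    obtain e where e: "e > 0" "sF e x \<in> G" by (rule f.F.absorbs_pos[OF G(1)])
    then have "sF e x \<in> ?S" using G(2) by blast
    then have "sF (1/e) (sF e x) \<in> ?S" by (rule f.F.subspace_scale[OF S])
    then show ?thesis using e(1) by simp
  qed
  then show ?thesis using P(1) by blast
qed

end

section \<open>Restriction of scalars\<close>

text \<open>Convexity involves the scalars only through \<open>of_real\<close>, and topology and
  completeness do not involve them at all.\<close>

lemma real_frechet_of_real:
  fixes s :: "'a::real_normed_field \<Rightarrow> 'b::{uniform_topological_group_add, ab_group_add} \<Rightarrow> 'b"
  assumes "frechet_space s"
  shows "real_frechet (\<lambda>r. s (of_real r))"
proof -
  interpret frechet_space s by (fact assms)
  show ?thesis
  proof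
    have "continuous_on UNIV (\<lambda>p::real \<times> 'b. (of_real (fst p) :: 'a, snd p))"
      by (intro continuous_intros)
    from continuous_on_compose2[OF continuous_scale this]
    show "continuous_on UNIV (\<lambda>(r, x). s (of_real r) x)"
      by (simp add: case_prod_unfold)
    show "\<exists>V. 0 \<in> interior V \<and> V \<subseteq> U \<and> convex_wrt (\<lambda>r. s (of_real r)) V"
      if "0 \<in> interior U" for U
      using locally_convex[OF that] by (simp add: convex_wrt_def)
  qed (simp_all add: scale_right_distrib scale_left_distrib metrizable complete)
qed

lemma linear_of_real:
  assumes "Vector_Spaces.linear s t f"
  shows "Vector_Spaces.linear (\<lambda>r. s (of_real r)) (\<lambda>r. t (of_real r)) f"
proof -
  interpret Vector_Spaces.linear s t f by (fact assms)
  show ?thesis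
  proof
    show "f (x + y) = f x + f y" for x y by (rule add)
    show "f (s (of_real c) x) = t (of_real c) (f x)" for c x by (rule scale)
  qed (simp_all add: vs1.scale_right_distrib vs1.scale_left_distrib vs2.scale_right_distrib
      vs2.scale_left_distrib)
qed

section \<open>Quotients and finite codimension\<close>

context vector_space
begin

lemma quotient_subspace_quotient_space:
  assumes M: "subspace M"
  shows "quotient_subspace scale M (quotient_space M)"
  unfolding quotient_subspace_def quotient_space_def
proof (intro conjI ballI allI)
  show "M \<in> range (\<lambda>x. x +o M)" by (rule range_eqI[of _ _ 0]) (simp add: elt_set_plus_def)
qed (auto simp: coset_add[OF M] coset_scale[OF M])

lemma subspace_coset_vimage:
  assumes M: "subspace M" and S: "quotient_subspace scale M S"
  shows "subspace {x. x +o M \<in> S}"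
proof (rule subspaceI)
  show "0 \<in> {x. x +o M \<in> S}"
    using S by (simp add: quotient_subspace_def elt_set_plus_def)
  show "x + y \<in> {x. x +o M \<in> S}" if "x \<in> {x. x +o M \<in> S}" "y \<in> {x. x +o M \<in> S}" for x y
    using S that by (simp add: quotient_subspace_def coset_add[OF M, symmetric])
  show "scale c x \<in> {x. x +o M \<in> S}" if "x \<in> {x. x +o M \<in> S}" for c x
    using S that by (simp add: quotient_subspace_def coset_scale[OF M, symmetric])
qed

lemma coset_absorb:
  assumes M: "subspace M" and "x \<in> M"
  shows "x +o M = M"
proof -
  have "\<exists>m\<in>M. y = x + m" if "y \<in> M" for y
    using subspace_diff[OF M that assms(2)] by (intro bexI[of _ "y - x"]) auto
  then show ?thesis
    using subspace_add[OF M assms(2)] by (auto simp: elt_set_plus_def)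
qed

text \<open>Every subspace over the full field is a real subspace, so it contains the real span of
  \<open>P\<close> once it contains \<open>P\<close>. The cosets of a real complement therefore
  generate the quotient over the full field.\<close>

lemma finite_codimension_of_real:
  fixes of_r :: "real \<Rightarrow> 'a"
  assumes M: "subspace M" and P: "finite P"
    and real: "vector_space (\<lambda>r. scale (of_r r))"
    and UNIV: "M + module.span (\<lambda>r. scale (of_r r)) P = UNIV"
  shows "finite_codimension scale M"
proof -
  interpret R: vector_space "\<lambda>r. scale (of_r r)" by (fact real)
  let ?B = "(\<lambda>x. x +o M) ` P"
  have B: "?B \<subseteq> quotient_space M" by (auto simp: quotient_space_def)
  have "quotient_space M \<subseteq> S" if S: "quotient_subspace scale M S" "?B \<subseteq> S" for S
  proof -
    \<comment> \<open>The preimage of \<open>S\<close> under the quotient map contains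
      \<open>M\<close> and \<open>P\<close>, hence everything.\<close>
    let ?T = "{x. x +o M \<in> S}"
    have T: "subspace ?T" using M S(1) by (rule subspace_coset_vimage)
    then have "R.subspace ?T" by (auto simp: R.subspace_def subspace_def)
    moreover have "P \<subseteq> ?T" using S(2) by auto
    ultimately have "R.span P \<subseteq> ?T" by (rule R.span_minimal[rotated])
    moreover have "M \<subseteq> ?T"
      using coset_absorb[OF M] S(1) by (auto simp: quotient_subspace_def)
    ultimately have "M + R.span P \<subseteq> ?T"
      using subspace_add[OF T] by (auto simp: set_plus_def)
    then show ?thesis unfolding UNIV by (auto simp: quotient_space_def)
  qed
  then have "quotient_span scale M ?B = quotient_space M"
    unfolding quotient_span_def
    using quotient_subspace_quotient_space[OF M] B by (intro hull_unique)
  then show ?thesis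
    unfolding finite_codimension_def using P B by blast
qed

end

theorem theorem1:
  fixes scaleE :: "'k::real_normed_field \<Rightarrow> 'e::{uniform_topological_group_add, ab_group_add} \<Rightarrow> 'e"
    and scaleF :: "'k \<Rightarrow> 'f::{uniform_topological_group_add, ab_group_add} \<Rightarrow> 'f"
    and f g :: "'e \<Rightarrow> 'f"
    and U :: "'e set"
  assumes "frechet_space scaleE"
    and "frechet_space scaleF"
    and "Vector_Spaces.linear scaleE scaleF f"
    and "continuous_on UNIV f"
    and "Vector_Spaces.linear scaleE scaleF g"
    and "continuous_on UNIV g"
    and "surj g"
    and "0 \<in> interior U"
    and "compact (closure (f ` U))"
  shows "module.subspace scaleF (range (\<lambda>x. f x + g x)) \<and>
         closed (range (\<lambda>x. f x + g x)) \<and>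
         finite_codimension scaleF (range (\<lambda>x. f x + g x))"
proof -
  interpret kF: frechet_space scaleF by (fact assms(2))
  interpret kf: Vector_Spaces.linear scaleE scaleF f by (fact assms(3))
  interpret kg: Vector_Spaces.linear scaleE scaleF g by (fact assms(5))
  interpret E: real_frechet "\<lambda>r. scaleE (of_real r)"
    using assms(1) by (rule real_frechet_of_real)
  interpret F: real_frechet "\<lambda>r. scaleF (of_real r)"
    using assms(2) by (rule real_frechet_of_real)
  \<comment> \<open>\<open>U\<close> is replaced by a disc inside it; the closure of the smaller
    image is a closed subset of a compact set.\<close>
  obtain W where W: "E.disc_nhd W" "W \<subseteq> U" using assms(8) by (rule E.disc_nhd_subset)
  have sub: "closure (f ` W) \<subseteq> closure (f ` U)" using W(2) by (intro closure_mono image_mono)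
  have "compact (closure (f ` U) \<inter> closure (f ` W))"
    using assms(9) closed_closure by (rule compact_Int_closed)
  then have compact: "compact (closure (f ` W))" using sub by (simp add: Int_absorb1)
  interpret compact_perturbation "\<lambda>r. scaleE (of_real r)" "\<lambda>r. scaleF (of_real r)" f g W
    by (intro compact_perturbation.intro compact_perturbation_axioms.intro frechet_map.intro
        frechet_map_axioms.intro linear_of_real[OF assms(3)] linear_of_real[OF assms(5)]
        E.real_frechet_axioms F.real_frechet_axioms assms(4,6,7) W(1) compact)
  \<comment> \<open>The real theory yields only a real subspace, so closure under the full scalar
    field is checked here.\<close>
  have M: "kF.subspace (range h)"
  proof (rule kF.subspaceI)
    show "0 \<in> range h" by (rule range_eqI[of _ _ 0]) (simp add: kf.zero kg.zero)
    show "x + y \<in> range h" if "x \<in> range h" "y \<in> range h" for x y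
    proof -
      obtain a b where "x = h a" "y = h b" using \<open>x \<in> range h\<close> \<open>y \<in> range h\<close> by blast
      then show ?thesis by (intro range_eqI[of _ _ "a + b"]) (simp add: kf.add kg.add)
    qed
    show "scaleF c x \<in> range h" if "x \<in> range h" for c x
    proof -
      obtain a where "x = h a" using \<open>x \<in> range h\<close> by blast
      then show ?thesis
        by (intro range_eqI[of _ _ "scaleE c a"]) (simp add: kf.scale kg.scale kF.scale_right_distrib)
    qed
  qed
  obtain P where P: "finite P" "range h + F.span P = UNIV" using finite_complement by blast
  have "finite_codimension scaleF (range h)"
    using M P(1) F.vector_space_axioms P(2) by (rule kF.finite_codimension_of_real)
  then show ?thesis using M closed_range by blast
qed

end
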